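(* Let $\mathcal{K}=\langle K_1,\dots,K_r\rangle$ be an Alexander $r$-tuple of simplicial complexes $K_i\subsetneq2^{[n]}$ (with $\{1\}\in K_1$). Then $Bier(\mathcal{K})=K_1\ast_\Delta\cdots\ast_\Delta K_r$ is homotopy equivalent to a wedge of $(n-r)$-dimensional spheres in which the number of spheres equals the number of critical simplices, other than the distinguished $0$-dimensional critical simplex $(\{1\},\emptyset,\dots,\emptyset;\{2,\dots,n\})$, of the discrete Morse function $D$ on $Bier(\mathcal{K})$ defined in the context.
   Context: $[n]=\{1,\dots,n\}$. A simplicial complex on $[n]$ is a subset $K\subseteq2^{[n]}$ with $\emptyset\in K$ that is closed under taking subsets; all complexes $K_i$ are assumed proper ($K_i\ne2^{[n]}$). $\langle K_1,\dots,K_r\rangle$ is collective $r$-unavoidable if for each ordered collection $(A_1,\dots,A_r)$ of pairwise disjoint subsets of $[n]$ there exists $i$ with $A_i\in K_i$. It is an Alexander $r$-tuple if it is collective $r$-unavoidable and, for all $A_1\in K_1,\dots,A_r\in K_r$, the set $[n]\setminus\bigcup_i A_i$ has at least $r-1$ elements. The deleted join $K_1\ast_\Delta\cdots\ast_\Delta K_r$ is the simplicial complex (with vertices in $[n]\times[r]$) whose simplices are $A_1\uplus\cdots\uplus A_r$ with $A_i\in K_i$ pairwise disjoint. For an Alexander $r$-tuple it is called the Bier complex $Bier(\mathcal{K})$. Its non-empty simplices are written as ordered partitions $(A_1,\dots,A_r;B)$ of $[n]$ with $A_i\in K_i$, $\bigcup_iA_i\neq\emptyset$ and $B=[n]\setminus\bigcup_iA_i$;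 the dimension is $n-|B|-1$. A discrete vector field on a simplicial complex is a set of pairs $(\alpha^p,\beta^{p+1})$ of simplices, $p\ge0$ (the empty simplex is never matched), such that $\alpha^p$ is a facet of $\beta^{p+1}$ and each simplex is in at most one pair. A gradient path is a sequence $\alpha_0^p,\beta_0^{p+1},\alpha_1^p,\beta_1^{p+1},\dots,\alpha_m^p,\beta_m^{p+1},\alpha_{m+1}^p$ with each $(\alpha_i^p,\beta_i^{p+1})$ a pair of the field, $\alpha_{i+1}^p$ a facet of $\beta_i^{p+1}$, and $\alpha_i\ne\alpha_{i+1}$; it is closed if $\alpha_{m+1}^p=\alpha_0^p$. A discrete Morse function is a discrete vector field without closed gradient paths. Critical simplices are the (non-empty) simplices that are not matched. The discrete Morse function $D$. The order on $[n]$ and on the tuple is chosen so that $\{1\}\in K_1$. To a simplex $(A_1,\dots,A_r;B)$ assign $\mathbf{a}=(a_1,\dots,a_r)\in(\mathbb{N}\cup\{\infty\})^r$ by: $a_1=\min(B\cup A_1)$, and for $i\ge2$, $a_i=\min((B\cup A_i)\setminus[1,a_{i-1}])$; if the set whose minimum is taken at step $i$ is empty, then $a_k=\infty$ for all $k\ge i$. An element $a_j\neq\infty$ is movable if either $a_j\in B$ and $A_j\cup\{a_j\}\in K_j$, or $a_j\in A_j$. The standard move of a movable $a_j$ matches $(A_1,\dots,A_j,\dots,A_r;B)$ with $(A_1,\dots,A_j\cup\{a_j\},\dots,A_r;B\setminus\{a_j\})$ if $a_j\in B$, and with $(A_1,\dots,A_j\setminus\{a_j\},\dots,A_r;B\cup\{a_j\})$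 if $a_j\in A_j$. In $D$, each simplex is matched with the one obtained by the standard move of its minimal movable element; a simplex with no movable element is critical. Since the partition $(\emptyset,\dots,\emptyset;[n])$ (the empty simplex) is excluded from matching, the simplex $(\{1\},\emptyset,\dots,\emptyset;\{2,\dots,n\})$ is also critical. *)

theory Defs
  imports "HOL-Homology.Homology" "HOL-Library.Extended_Nat" "HOL-Library.Disjoint_Sets"
begin

text \<open>Throughout, \<open>[n]\<close> is \<open>{1..n}\<close> and a tuple \<open>K\<^sub>1, \<dots>, K\<^sub>r\<close> is a function
  \<open>K :: nat \<Rightarrow> nat set set\<close> of which only the values on \<open>{1..r}\<close> matter.\<close>

section \<open>Alexander tuples and Bier complexes\<close>

definition abstract_complex :: "nat \<Rightarrow> nat set set \<Rightarrow> bool" where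
  "abstract_complex n K \<longleftrightarrow>
     K \<subseteq> Pow {1..n} \<and> {} \<in> K \<and> (\<forall>S\<in>K. \<forall>T. T \<subseteq> S \<longrightarrow> T \<in> K)"

definition collective_unavoidable :: "nat \<Rightarrow> nat \<Rightarrow> (nat \<Rightarrow> nat set set) \<Rightarrow> bool" where
  "collective_unavoidable n r K \<longleftrightarrow>
     (\<forall>A. (\<forall>i\<in>{1..r}. A i \<subseteq> {1..n}) \<and> disjoint_family_on A {1..r}
          \<longrightarrow> (\<exists>i\<in>{1..r}. A i \<in> K i))"

definition alexander_tuple :: "nat \<Rightarrow> nat \<Rightarrow> (nat \<Rightarrow> nat set set) \<Rightarrow> bool" where
  "alexander_tuple n r K \<longleftrightarrow>
     collective_unavoidable n r K \<and>
     (\<forall>A. (\<forall>i\<in>{1..r}. A i \<in> K i) \<longrightarrow> r - 1 \<le> card ({1..n} - (\<Union>i\<in>{1..r}. A i)))"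

text \<open>The simplex \<open>A\<^sub>1 \<uplus> \<dots> \<uplus> A\<^sub>r\<close> is the set of all \<open>(v, i)\<close> with \<open>v \<in> A\<^sub>i\<close>; the empty
  simplex is included.\<close>

definition deleted_join :: "nat \<Rightarrow> (nat \<Rightarrow> nat set set) \<Rightarrow> (nat \<times> nat) set set" where
  "deleted_join r K =
     {\<Union>i\<in>{1..r}. A i \<times> {i} | A.
        (\<forall>i\<in>{1..r}. A i \<in> K i) \<and> disjoint_family_on A {1..r}}"

abbreviation bier :: "nat \<Rightarrow> (nat \<Rightarrow> nat set set) \<Rightarrow> (nat \<times> nat) set set" where
  "bier r K \<equiv> deleted_join r K"

text \<open>The ordered partition \<open>(A\<^sub>1, \<dots>, A\<^sub>r; B)\<close> of \<open>[n]\<close> encoded by a simplex \<open>\<sigma>\<close> of the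
  deleted join: \<open>A\<^sub>i = part \<sigma> i\<close> and \<open>B = rest n \<sigma>\<close>.\<close>

definition part :: "(nat \<times> nat) set \<Rightarrow> nat \<Rightarrow> nat set" where
  "part \<sigma> i = {v. (v, i) \<in> \<sigma>}"

definition rest :: "nat \<Rightarrow> (nat \<times> nat) set \<Rightarrow> nat set" where
  "rest n \<sigma> = {1..n} - fst ` \<sigma>"

section \<open>The discrete Morse function \<open>D\<close>\<close>

text \<open>\<open>aval n \<sigma> i\<close> is \<open>a\<^sub>i\<close>. The auxiliary value \<open>a\<^sub>0 = 0\<close> removes nothing from
  \<open>B \<union> A\<^sub>1 \<subseteq> {1..n}\<close>. Once \<open>a\<^sub>i = \<infinity>\<close>, the candidate set at all later steps is empty, so all
  later values are \<open>\<infinity>\<close> as well.\<close>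

fun aval :: "nat \<Rightarrow> (nat \<times> nat) set \<Rightarrow> nat \<Rightarrow> enat" where
  "aval n \<sigma> 0 = 0"
| "aval n \<sigma> (Suc i) =
     (let C = {x \<in> rest n \<sigma> \<union> part \<sigma> (Suc i). aval n \<sigma> i < enat x}
      in if C = {} then \<infinity> else enat (Min C))"

definition movable :: "nat \<Rightarrow> nat \<Rightarrow> (nat \<Rightarrow> nat set set) \<Rightarrow> (nat \<times> nat) set \<Rightarrow> nat \<Rightarrow> bool" where
  "movable n r K \<sigma> j \<longleftrightarrow>
     j \<in> {1..r} \<and>
     (\<exists>a. aval n \<sigma> j = enat a \<and>
        (a \<in> rest n \<sigma> \<and> insert a (part \<sigma> j) \<in> K j \<or> a \<in> part \<sigma> j))"

definition standard_move :: "nat \<Rightarrow> (nat \<times> nat) set \<Rightarrow> nat \<Rightarrow> (nat \<times> nat) set" where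
  "standard_move n \<sigma> j =
     (let a = the_enat (aval n \<sigma> j)
      in if a \<in> part \<sigma> j then \<sigma> - {(a, j)} else insert (a, j) \<sigma>)"

definition min_movable :: "nat \<Rightarrow> nat \<Rightarrow> (nat \<Rightarrow> nat set set) \<Rightarrow> (nat \<times> nat) set \<Rightarrow> nat \<Rightarrow> bool" where
  "min_movable n r K \<sigma> j \<longleftrightarrow>
     movable n r K \<sigma> j \<and> (\<forall>k. movable n r K \<sigma> k \<longrightarrow> aval n \<sigma> j \<le> aval n \<sigma> k)"

definition matched_with ::
    "nat \<Rightarrow> nat \<Rightarrow> (nat \<Rightarrow> nat set set) \<Rightarrow> (nat \<times> nat) set \<Rightarrow> (nat \<times> nat) set \<Rightarrow> bool" where
  "matched_with n r K \<sigma> \<tau> \<longleftrightarrow> (\<exists>j. min_movable n r K \<sigma> j \<and> \<tau> = standard_move n \<sigma> j)"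

text \<open>\<open>D\<close> as a set of pairs \<open>(\<alpha>, \<beta>)\<close>, the smaller simplex first; the empty simplex is
  never matched.\<close>

definition D_field ::
    "nat \<Rightarrow> nat \<Rightarrow> (nat \<Rightarrow> nat set set) \<Rightarrow> ((nat \<times> nat) set \<times> (nat \<times> nat) set) set" where
  "D_field n r K =
     {(\<alpha>, \<beta>). \<alpha> \<in> bier r K - {{}} \<and> \<beta> \<in> bier r K - {{}} \<and> \<alpha> \<subset> \<beta> \<and>
        (matched_with n r K \<alpha> \<beta> \<or> matched_with n r K \<beta> \<alpha>)}"

definition critical_simplices :: "'v set set \<Rightarrow> ('v set \<times> 'v set) set \<Rightarrow> 'v set set" where
  "critical_simplices S V = {\<sigma> \<in> S. \<sigma> \<noteq> {} \<and> (\<forall>(\<alpha>, \<beta>) \<in> V. \<sigma> \<noteq> \<alpha> \<and> \<sigma> \<noteq> \<beta>)}"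

section \<open>Geometric realization and wedges of spheres\<close>

text \<open>Barycentric coordinates, with the topology of pointwise convergence. For finite
  complexes this is the usual topology of the realization.\<close>

definition geometric_realization :: "'v set set \<Rightarrow> ('v \<Rightarrow> real) topology" where
  "geometric_realization S =
     subtopology (powertop_real UNIV)
       {x. (\<forall>v. 0 \<le> x v) \<and> {v. x v \<noteq> 0} \<in> S \<and> (\<Sum>v | x v \<noteq> 0. x v) = 1}"

text \<open>The wedge of pointed spaces \<open>(X i, b i)\<close>, \<open>i \<in> I\<close>, is the quotient of their disjoint
  union by the identification of all base points to the single point \<open>None\<close>. The point
  \<open>None\<close> is always present, so that the wedge of the empty family is one point.\<close>

definition wedge_collapse :: "('i \<Rightarrow> 'a) \<Rightarrow> 'i \<times> 'a \<Rightarrow> ('i \<times> 'a) option" where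
  "wedge_collapse b p = (if snd p = b (fst p) then None else Some p)"

definition wedge :: "('i \<Rightarrow> 'a topology) \<Rightarrow> ('i \<Rightarrow> 'a) \<Rightarrow> 'i set \<Rightarrow> ('i \<times> 'a) option topology" where
  "wedge X b I =
     topology (\<lambda>U. U \<subseteq> insert None (wedge_collapse b ` topspace (sum_topology X I)) \<and>
        openin (sum_topology X I)
          {p \<in> topspace (sum_topology X I). wedge_collapse b p \<in> U})"

lemma openin_wedge:
  "openin (wedge X b I) U \<longleftrightarrow>
     U \<subseteq> insert None (wedge_collapse b ` topspace (sum_topology X I)) \<and>
     openin (sum_topology X I) {p \<in> topspace (sum_topology X I). wedge_collapse b p \<in> U}"
proof -
  let ?S = "sum_topology X I"
  have "istopology (\<lambda>U. U \<subseteq> insert None (wedge_collapse b ` topspace ?S) \<and>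
          openin ?S {p \<in> topspace ?S. wedge_collapse b p \<in> U})"
    unfolding istopology_def
  proof (intro conjI allI impI; (elim conjE)?)
    fix U V
    assume "openin ?S {p \<in> topspace ?S. wedge_collapse b p \<in> U}"
      and "openin ?S {p \<in> topspace ?S. wedge_collapse b p \<in> V}"
    then have "openin ?S ({p \<in> topspace ?S. wedge_collapse b p \<in> U} \<inter>
        {p \<in> topspace ?S. wedge_collapse b p \<in> V})"
      by (rule openin_Int)
    moreover have "{p \<in> topspace ?S. wedge_collapse b p \<in> U} \<inter>
        {p \<in> topspace ?S. wedge_collapse b p \<in> V} =
        {p \<in> topspace ?S. wedge_collapse b p \<in> U \<inter> V}"
      by blast
    ultimately show "openin ?S {p \<in> topspace ?S. wedge_collapse b p \<in> U \<inter> V}"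
      by simp
  next
    fix \<U>
    assume *: "\<forall>U\<in>\<U>. U \<subseteq> insert None (wedge_collapse b ` topspace ?S) \<and>
        openin ?S {p \<in> topspace ?S. wedge_collapse b p \<in> U}"
    have "openin ?S (\<Union>U\<in>\<U>. {p \<in> topspace ?S. wedge_collapse b p \<in> U})"
      using * by (intro openin_Union) auto
    moreover have "(\<Union>U\<in>\<U>. {p \<in> topspace ?S. wedge_collapse b p \<in> U}) =
        {p \<in> topspace ?S. wedge_collapse b p \<in> \<Union>\<U>}"
      by blast
    ultimately show "openin ?S {p \<in> topspace ?S. wedge_collapse b p \<in> \<Union>\<U>}"
      by simp
  qed auto
  then show ?thesis
    unfolding wedge_def by simp
qed

lemma topspace_wedge:
  "topspace (wedge X b I) = insert None (wedge_collapse b ` topspace (sum_topology X I))"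
    (is "_ = ?W")
proof
  show "topspace (wedge X b I) \<subseteq> ?W"
    using openin_topspace[of "wedge X b I"] by (simp only: openin_wedge)
  have "{p \<in> topspace (sum_topology X I). wedge_collapse b p \<in> ?W} = topspace (sum_topology X I)"
    by blast
  then have "openin (wedge X b I) ?W"
    by (simp only: openin_wedge openin_topspace order_refl simp_thms)
  then show "?W \<subseteq> topspace (wedge X b I)"
    by (rule openin_subset)
qed

lemma quotient_map_wedge_collapse:
  assumes "I \<noteq> {}" and "\<And>i. i \<in> I \<Longrightarrow> b i \<in> topspace (X i)"
  shows "quotient_map (sum_topology X I) (wedge X b I) (wedge_collapse b)"
proof -
  obtain i where "i \<in> I" using assms(1) by blast
  then have "(i, b i) \<in> topspace (sum_topology X I)"
    using assms(2) by simp
  moreover have "wedge_collapse b (i, b i) = None"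
    by (simp add: wedge_collapse_def)
  ultimately have "None \<in> wedge_collapse b ` topspace (sum_topology X I)"
    using image_eqI[of None "wedge_collapse b" "(i, b i)"] by simp
  then have "wedge_collapse b ` topspace (sum_topology X I) = topspace (wedge X b I)"
    by (simp only: topspace_wedge insert_absorb)
  then show ?thesis
    unfolding quotient_map_def by (simp add: openin_wedge topspace_wedge)
qed

text \<open>The wedge of \<open>m\<close> copies of the \<open>d\<close>-sphere, each based at \<open>(1, 0, \<dots>, 0)\<close>. For \<open>d = 0\<close>
  the sphere has two points and the wedge is discrete with \<open>m + 1\<close> points.\<close>

definition wedge_of_spheres :: "nat \<Rightarrow> nat \<Rightarrow> (nat \<times> (nat \<Rightarrow> real)) option topology" where
  "wedge_of_spheres d m =
     wedge (\<lambda>_. nsphere d) (\<lambda>_ k. if k = 0 then 1 else 0) {..<m}"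

text \<open>Under the hypotheses used below, the subtraction \<open>n - r\<close> does not truncate.\<close>

lemma alexander_tuple_le:
  assumes "\<And>i. i \<in> {1..r} \<Longrightarrow> abstract_complex n (K i)"
    and "alexander_tuple n r K" and "{1} \<in> K 1"
  shows "r \<le> n"
proof (cases "r = 0")
  case False
  define A where "A = (\<lambda>i::nat. if i = 1 then {1::nat} else {})"
  have "\<forall>i\<in>{1..r}. A i \<in> K i"
    using assms(1,3) by (auto simp: A_def abstract_complex_def)
  then have "r - 1 \<le> card ({1..n} - (\<Union>i\<in>{1..r}. A i))"
    using assms(2) by (auto simp: alexander_tuple_def)
  moreover have "(\<Union>i\<in>{1..r}. A i) = {1}"
    using False by (auto simp: A_def)
  moreover have "1 \<in> {1..n}"
    using assms(1)[of 1] assms(3) False by (auto simp: abstract_complex_def)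
  ultimately show ?thesis
    using False by (simp add: card_Diff_singleton)
qed simp

end

theory Submission
  imports Defs
begin

text \<open>Extend the matching \<open>D\<close> by the pair of the empty simplex with \<open>{(1, 1)}\<close>. It is acyclic: along
  a gradient path the vector \<open>(a\<^sub>1, \<dots>, a\<^sub>r)\<close> never increases lexicographically, and while it stays
  constant the index of the minimal movable element decreases. If no \<open>a\<^sub>j\<close> of a simplex is movable, then
  unavoidability forces some \<open>a\<^sub>j\<close> to be infinite, so that \<open>B\<close> consists of finite values \<open>a\<^sub>i\<close> only and
  has at most \<open>r - 1\<close> elements; hence the unmatched simplices are facets of dimension \<open>n - r\<close>.
  Removing these facets leaves a complex with a perfect acyclic matching. It collapses to a point,
  and a complex with a contractible subcomplex is homotopy equivalent to the quotient by it, here the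
  wedge of the removed facets with their boundaries collapsed.\<close>

section \<open>Collapses and acyclic matchings\<close>

text \<open>All unmatched simplices are maximal, so no cells have to be attached in the order of a
  Morse function: they are removed together, and how their boundaries meet the rest is irrelevant,
  because the rest is contractible. Their maximality needs the other half of the Alexander
  condition, which gives |B| \<ge> r - 1 for every simplex and so turns the bound from
  unavoidability into an equality. Without the extra pair at the empty simplex the complement would
  have an unmatched vertex; with it, one collapsing induction runs without exceptions until only the
  empty simplex and a vertex are left. The vector cannot grow because a matched step leaves it
  unchanged, while discarding another vertex enlarges B and with it every set of which a minimum is
  taken. The quotient is not formed abstractly. An explicit map onto the wedge has the fibres of the
  quotient, and as a continuous surjection from a compact space onto a Hausdorff space it is a
  quotient map.\<close>

definition realization_points :: "'v set set \<Rightarrow> ('v \<Rightarrow> real) set" where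
  "realization_points S =
     {x. (\<forall>v. 0 \<le> x v) \<and> {v. x v \<noteq> 0} \<in> S \<and> (\<Sum>v | x v \<noteq> 0. x v) = 1}"

lemma geometric_realization_eq:
  "geometric_realization S = top_of_set (realization_points S)"
  by (simp add: geometric_realization_def realization_points_def euclidean_product_topology)

lemma realization_points_iff:
  assumes "finite V" "\<Union>S \<subseteq> V"
  shows "x \<in> realization_points S \<longleftrightarrow> (\<forall>v. 0 \<le> x v) \<and> {v. x v \<noteq> 0} \<in> S \<and> sum x V = 1"
proof -
  have "(\<Sum>v | x v \<noteq> 0. x v) = sum x V" if "{v. x v \<noteq> 0} \<in> S"
    using that assms by (intro sum.mono_neutral_left) auto
  then show ?thesis
    by (auto simp: realization_points_def)
qed

lemma realization_points_mono: "S \<subseteq> T \<Longrightarrow> realization_points S \<subseteq> realization_points T"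
  by (auto simp: realization_points_def)

lemma continuous_on_Min:
  fixes f :: "'i \<Rightarrow> 'a::topological_space \<Rightarrow> real"
  assumes "finite F" "F \<noteq> {}" "\<And>i. i \<in> F \<Longrightarrow> continuous_on A (f i)"
  shows "continuous_on A (\<lambda>x. Min ((\<lambda>i. f i x) ` F))"
  using assms
proof (induction F rule: finite_ne_induct)
  case (insert i F)
  then have "continuous_on A (\<lambda>x. min (f i x) (Min ((\<lambda>i. f i x) ` F)))"
    by (intro continuous_on_min) auto
  then show ?case
    using insert.hyps by simp
qed simp

lemma continuous_on_coordinate:
  "continuous_on A (\<lambda>x. x i)"
  by (rule continuous_on_product_then_coordinatewise[OF continuous_on_id])

lemma continuous_on_snd_coordinate:
  "continuous_on A (\<lambda>p. snd p i)"
  by (rule continuous_on_product_then_coordinatewise[OF continuous_on_snd[OF continuous_on_id]])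

text \<open>The minimum over \<open>F\<close> is a continuous way of telling whether the support
  contains \<open>F\<close>. It measures the position relative to a free face in a collapse and
  relative to a removed facet later.\<close>

lemma Min_coordinates_nonneg:
  fixes x :: "'v \<Rightarrow> real"
  assumes "finite F" "F \<noteq> {}" "\<And>v. 0 \<le> x v"
  shows "0 \<le> Min (x ` F)" "0 < Min (x ` F) \<longleftrightarrow> F \<subseteq> {v. x v \<noteq> 0}"
proof -
  have "\<And>v. 0 < x v \<longleftrightarrow> x v \<noteq> 0"
    using assms(3) by (simp add: less_le)
  then show "0 \<le> Min (x ` F)" "0 < Min (x ` F) \<longleftrightarrow> F \<subseteq> {v. x v \<noteq> 0}"
    using assms by (auto simp: Min_gr_iff)
qed

text \<open>The deformation moves the common mass \<open>m\<close> of the vertices of \<open>\<alpha>\<close> to the vertex \<open>v\<close>; it is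
  constant off the open faces \<open>\<alpha>\<close> and \<open>insert v \<alpha>\<close>, where \<open>m = 0\<close>.\<close>

lemma elementary_collapse:
  assumes fin: "finite (\<Union>S)" and down: "\<And>\<sigma> \<tau>. \<sigma> \<in> S \<Longrightarrow> \<tau> \<subseteq> \<sigma> \<Longrightarrow> \<tau> \<in> S"
    and \<alpha>: "\<alpha> \<noteq> {}" "v \<notin> \<alpha>" "insert v \<alpha> \<in> S"
    and free: "\<And>\<gamma>. \<gamma> \<in> S \<Longrightarrow> \<alpha> \<subseteq> \<gamma> \<Longrightarrow> \<gamma> = \<alpha> \<or> \<gamma> = insert v \<alpha>"
  shows "geometric_realization S homotopy_equivalent_space
    geometric_realization (S - {\<alpha>, insert v \<alpha>})"
proof -
  define V where "V = \<Union>S"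
  define T where "T = S - {\<alpha>, insert v \<alpha>}"
  have V: "finite V" "\<Union>S \<subseteq> V" "\<Union>T \<subseteq> V" "insert v \<alpha> \<subseteq> V"
    using fin \<alpha> by (auto simp: V_def T_def)
  then have fin\<alpha>: "finite \<alpha>"
    by (meson finite_insert finite_subset)
  \<comment> \<open>The direction \<open>e\<close> has total mass 0: every vertex of
    \<open>\<alpha>\<close> gives one unit and \<open>v\<close> receives them all, so coordinate
    sums are preserved.\<close>
  define e where "e w = (if w = v then real (card \<alpha>) else if w \<in> \<alpha> then -1 else 0)" for w
  define m where "m x = Min (x ` \<alpha>)" for x :: "'a \<Rightarrow> real"
  define f where "f s x = (\<lambda>w. x w + s * m x * e w)" for s and x :: "'a \<Rightarrow> real"
  have sum_e: "sum e V = 0"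
  proof -
    have "sum e V = sum e (insert v \<alpha>)"
      using V by (intro sum.mono_neutral_right) (auto simp: e_def)
    also have "\<dots> = real (card \<alpha>) + (\<Sum>w\<in>\<alpha>. -1)"
    proof -
      have "sum e \<alpha> = (\<Sum>w\<in>\<alpha>. -1)"
        using \<alpha> by (intro sum.cong) (auto simp: e_def)
      then show ?thesis
        using \<alpha> fin\<alpha> by (simp add: e_def)
    qed
    finally show ?thesis by simp
  qed
  have m: "0 \<le> m x" "0 < m x \<longleftrightarrow> \<alpha> \<subseteq> {v. x v \<noteq> 0}" if "\<And>v. 0 \<le> x v" for x
    using Min_coordinates_nonneg[OF fin\<alpha> \<alpha>(1), of x] that by (auto simp: m_def)
  have f_in: "f s x \<in> realization_points S" if s: "0 \<le> s" "s \<le> 1" and x: "x \<in> realization_points S" for s x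
  proof -
    note xx = x[unfolded realization_points_iff[OF V(1,2)]]
    show ?thesis
    proof (cases "m x = 0")
      case True
      then show ?thesis using x by (simp add: f_def)
    next
      case False
      then have mpos: "0 < m x" and sub: "\<alpha> \<subseteq> {v. x v \<noteq> 0}"
        using m[of x] xx by auto
      \<comment> \<open>A positive \<open>m x\<close> puts \<open>\<alpha>\<close> into the support,
        and freeness then confines the support to \<open>insert v \<alpha>\<close>. The deformation
        thus stays in one closed face.\<close>
      then have sub2: "{v. x v \<noteq> 0} \<subseteq> insert v \<alpha>"
        using free[of "{v. x v \<noteq> 0}"] xx by auto
      have "0 \<le> f s x w" for w
      proof (cases "w \<in> \<alpha>")
        case True
        then have "s * m x \<le> 1 * x w"
          using s mpos fin\<alpha> by (intro mult_mono) (auto simp: m_def)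
        then show ?thesis using True \<alpha> by (auto simp: f_def e_def)
      qed (use s mpos xx in \<open>auto simp: f_def e_def\<close>)
      moreover have "{w. f s x w \<noteq> 0} \<subseteq> insert v \<alpha>"
        using sub2 by (auto simp: f_def e_def)
      then have "{w. f s x w \<noteq> 0} \<in> S"
        using down \<alpha>(3) by blast
      moreover have "sum (f s x) V = 1"
        using xx sum_e by (simp add: f_def sum.distrib flip: sum_distrib_left)
      ultimately show ?thesis
        by (simp add: realization_points_iff[OF V(1,2)])
    qed
  qed
  have f1_in: "f 1 x \<in> realization_points T" if x: "x \<in> realization_points S" for x
  proof -
    have 1: "f 1 x \<in> realization_points S"
      using f_in x by simp
    \<comment> \<open>A vertex of \<open>\<alpha>\<close> that attains the minimum has lost its
      whole coordinate at time 1, so neither removed simplex can be the support.\<close>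
    have "m x \<in> x ` \<alpha>"
      using fin\<alpha> \<alpha> unfolding m_def by (intro Min_in) auto
    then obtain w where w: "w \<in> \<alpha>" "m x = x w"
      by blast
    then have "f 1 x w = 0"
      using \<alpha> by (auto simp: f_def e_def)
    then have "{w. f 1 x w \<noteq> 0} \<noteq> \<alpha>" "{w. f 1 x w \<noteq> 0} \<noteq> insert v \<alpha>"
      using w by auto
    then show ?thesis
      using 1 by (auto simp: realization_points_def T_def)
  qed
  have f_T: "f s x = x" if "x \<in> realization_points T" for s x
  proof -
    have "\<not> \<alpha> \<subseteq> {v. x v \<noteq> 0}" "\<And>v. 0 \<le> x v"
      using that free by (auto simp: realization_points_def T_def)
    then have "m x = 0" using m[of x] by auto
    then show ?thesis by (simp add: f_def)
  qed
  have "continuous_on A (\<lambda>x. m (snd x))" for A :: "(real \<times> ('a \<Rightarrow> real)) set"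
    unfolding m_def using fin\<alpha> \<alpha>(1) by (intro continuous_on_Min continuous_on_snd_coordinate)
  then have cont: "continuous_on A (\<lambda>p. f (fst p) (snd p))" for A
    unfolding f_def
    by (intro continuous_on_coordinatewise_then_product continuous_on_add continuous_on_mult
        continuous_on_snd_coordinate continuous_on_fst continuous_on_id continuous_on_const)
  have hom: "homotopic_with (\<lambda>x. True) (top_of_set (realization_points S))
    (top_of_set (realization_points S)) id (f 1)"
    unfolding homotopic_with_def
    using cont[of "{0..1} \<times> realization_points S"] f_in
    by (intro exI[of _ "\<lambda>p. f (fst p) (snd p)"]) (auto simp: f_def)
  then have "continuous_on (realization_points S) (f 1)"
    using homotopic_with_imp_continuous by blast
  then have "retraction_maps (top_of_set (realization_points S)) (top_of_set (realization_points T)) (f 1) id"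
    using f1_in f_T realization_points_mono[of T S] by (auto simp: retraction_maps_def T_def)
  with hom show ?thesis
    unfolding geometric_realization_eq T_def[symmetric]
    by (intro deformation_retract_imp_homotopy_equivalent_space) (simp_all add: homotopic_with_sym)
qed

text \<open>The collapsing ends here. The empty simplex contributes no point, since coordinates with
  empty support do not sum to 1; only the vertex remains.\<close>

lemma contractible_realization_edge_empty:
  "contractible_space (geometric_realization {{}, {v}})"
proof -
  have "realization_points {{}, {v}} \<subseteq> {\<lambda>w. if w = v then 1 else 0}"
  proof
    fix x assume x: "x \<in> realization_points {{}, {v}}"
    then have "{w. x w \<noteq> 0} = {v}"
      by (auto simp: realization_points_def)
    moreover from this have "x v = 1"
      using x by (simp add: realization_points_def)
    ultimately have "x = (\<lambda>w. if w = v then 1 else 0)"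
      by (auto simp: fun_eq_iff)
    then show "x \<in> {\<lambda>w. if w = v then 1 else 0}"
      by simp
  qed
  then show ?thesis
    unfolding geometric_realization_eq by (intro contractible_space_subset_singleton) simp
qed

text \<open>Among the lower partners of maximal cardinality, one that no other of them precedes on a gradient
  path is a free face; collapsing it leaves a smaller instance.\<close>

lemma acyclic_matching_contractible:
  fixes S :: "'v set set" and M :: "('v set \<times> 'v set) set"
  assumes "finite S" "\<And>\<sigma>. \<sigma> \<in> S \<Longrightarrow> finite \<sigma>" "\<And>\<sigma> \<tau>. \<sigma> \<in> S \<Longrightarrow> \<tau> \<subseteq> \<sigma> \<Longrightarrow> \<tau> \<in> S" "{} \<in> S"
    and "\<And>\<alpha> \<beta>. (\<alpha>, \<beta>) \<in> M \<Longrightarrow> \<beta> \<in> S \<and> (\<exists>v. v \<notin> \<alpha> \<and> \<beta> = insert v \<alpha>)"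
    and "\<And>\<sigma>. \<sigma> \<in> S \<Longrightarrow> \<exists>!p. p \<in> M \<and> (\<sigma> = fst p \<or> \<sigma> = snd p)"
    and "acyclic {(\<alpha>', \<alpha>). \<alpha>' \<noteq> \<alpha> \<and> (\<exists>\<beta>'. (\<alpha>', \<beta>') \<in> M) \<and> (\<exists>w. w \<notin> \<alpha>' \<and> (\<alpha>, insert w \<alpha>') \<in> M)}"
  shows "contractible_space (geometric_realization S)"
  using assms
proof (induction "card S" arbitrary: S M rule: less_induct)
  case less
  note fin = less.prems(1,2) and down = less.prems(3) and pairs = less.prems(5)
    and ex1 = less.prems(6) and acyc = less.prems(7)
  have uniq: "p = p'" if "p \<in> M" "p' \<in> M" "\<sigma> \<in> {fst p, snd p}" "\<sigma> \<in> {fst p', snd p'}" for \<sigma> p p'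
  proof -
    have "\<sigma> \<in> S"
      using pairs[of "fst p" "snd p"] that down by auto
    then show ?thesis
      using ex1[of \<sigma>] that by auto
  qed
  define U where "U = fst ` M"
  have "U \<subseteq> S"
    using pairs down by (force simp: U_def)
  then have finU: "finite U"
    using fin finite_subset by blast
  have "U \<noteq> {}"
    using ex1[OF less.prems(4)] by (auto simp: U_def)
  define d where "d = Max (card ` U)"
  define W where "W = {\<alpha> \<in> U. card \<alpha> = d}"
  have "d \<in> card ` U"
    unfolding d_def using finU \<open>U \<noteq> {}\<close> by (intro Max_in) auto
  then have "W \<noteq> {}"
    by (auto simp: W_def)
  have d_max: "card \<alpha> \<le> d" if "\<alpha> \<in> U" for \<alpha>
    using that finU by (auto simp: d_def)
  define R where "R = {(\<alpha>', \<alpha>). \<alpha>' \<noteq> \<alpha> \<and> (\<exists>\<beta>'. (\<alpha>', \<beta>') \<in> M) \<and> (\<exists>w. w \<notin> \<alpha>' \<and> (\<alpha>, insert w \<alpha>') \<in> M)}"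
  have "R \<subseteq> U \<times> U"
    by (force simp: R_def U_def)
  then have "finite R"
    using finU finite_subset by blast
  \<comment> \<open>A pair (\<alpha>', \<alpha>) of \<open>R\<close> is a gradient step from
    \<alpha> to \<alpha>', so a minimal element for the converse is one without a predecessor in
    \<open>W\<close>.\<close>
  then have "wf (R\<inverse>)"
    using acyc by (intro finite_acyclic_wf_converse) (auto simp: R_def)
  from wfE_min'[OF this \<open>W \<noteq> {}\<close>] obtain \<alpha>
    where \<alpha>: "\<alpha> \<in> W" and min: "\<And>\<alpha>'. (\<alpha>, \<alpha>') \<in> R \<Longrightarrow> \<alpha>' \<notin> W"
    by (simp only: converse_iff) blast
  then obtain \<beta> where \<beta>: "(\<alpha>, \<beta>) \<in> M"
    by (auto simp: W_def U_def)
  then obtain v where v: "v \<notin> \<alpha>" "(\<alpha>, insert v \<alpha>) \<in> M" "insert v \<alpha> \<in> S"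
    using pairs[OF \<beta>] by auto
  have card_\<alpha>: "card \<alpha> = d" and "\<alpha> \<in> S"
    using \<alpha> \<open>U \<subseteq> S\<close> by (auto simp: W_def)
  have fin\<alpha>: "finite \<alpha>"
    using fin \<open>\<alpha> \<in> S\<close> by blast
  \<comment> \<open>By the choice of \<open>d\<close>, \<open>insert w \<alpha>\<close> is too large
    to be a lower partner. It is the upper partner of some \<alpha>' in \<open>W\<close>, and if
    \<alpha>' differed from \<alpha>, it would precede \<alpha> on a gradient path.\<close>
  have up: "w = v" if w: "insert w \<alpha> \<in> S" "w \<notin> \<alpha>" for w
  proof -
    obtain p where p: "p \<in> M" "insert w \<alpha> = fst p \<or> insert w \<alpha> = snd p"
      using ex1[OF w(1)] by blast
    have "insert w \<alpha> \<noteq> fst p"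
    proof
      assume "insert w \<alpha> = fst p"
      then have "insert w \<alpha> \<in> U" using p by (auto simp: U_def)
      then show False
        using d_max card_\<alpha> fin\<alpha> w by force
    qed
    then obtain \<alpha>' where \<alpha>': "(\<alpha>', insert w \<alpha>) \<in> M"
      using p by (cases p) auto
    obtain u where u: "u \<notin> \<alpha>'" "insert w \<alpha> = insert u \<alpha>'"
      using pairs[OF \<alpha>'] by blast
    have "finite (insert u \<alpha>')"
      using fin\<alpha> by (simp flip: u(2))
    then have "card (insert u \<alpha>') = Suc (card \<alpha>')"
      using u(1) by simp
    then have "card \<alpha>' = d"
      using card_\<alpha> fin\<alpha> w by (simp flip: u(2))
    then have "\<alpha>' \<in> W"
      using \<alpha>' by (force simp: W_def U_def)
    have "\<alpha>' = \<alpha>"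
    proof (rule ccontr)
      assume "\<alpha>' \<noteq> \<alpha>"
      then have "(\<alpha>, \<alpha>') \<in> R"
        using \<alpha>' v w by (auto simp: R_def)
      then show False
        using min \<open>\<alpha>' \<in> W\<close> by blast
    qed
    then have "insert w \<alpha> = insert v \<alpha>"
      using uniq[OF \<alpha>' v(2), of \<alpha>] by simp
    then show "w = v"
      using w v by blast
  qed
  have free: "\<gamma> = \<alpha> \<or> \<gamma> = insert v \<alpha>" if "\<gamma> \<in> S" "\<alpha> \<subseteq> \<gamma>" for \<gamma>
  proof -
    have "w = v" if "w \<in> \<gamma> - \<alpha>" for w
      using that \<open>\<alpha> \<subseteq> \<gamma>\<close> by (intro up down[OF \<open>\<gamma> \<in> S\<close>]) auto
    then show ?thesis
      using \<open>\<alpha> \<subseteq> \<gamma>\<close> by auto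
  qed
  show ?case
  \<comment> \<open>If the empty simplex is free, a single pair is left. Removing it would leave no
    complex at all, so this is the base case.\<close>
  proof (cases "\<alpha> = {}")
    case True
    then have "\<gamma> = {} \<or> \<gamma> = {v}" if "\<gamma> \<in> S" for \<gamma>
      using free that by simp
    then have "S = {{}, {v}}"
      using True v less.prems(4) by auto
    then show ?thesis
      using contractible_realization_edge_empty by simp
  next
    case False
    define S' where "S' = S - {\<alpha>, insert v \<alpha>}"
    define M' where "M' = M - {(\<alpha>, insert v \<alpha>)}"
    have "contractible_space (geometric_realization S')"
    proof (rule less.hyps[of S' M'])
      show "card S' < card S"
        unfolding S'_def using fin \<open>\<alpha> \<in> S\<close> by (intro psubset_card_mono) auto
      show "{} \<in> S'"
        using less.prems(4) False by (auto simp: S'_def)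
      show "\<tau> \<in> S'" if "\<sigma> \<in> S'" "\<tau> \<subseteq> \<sigma>" for \<sigma> \<tau>
      proof -
        have "\<sigma> \<in> S" "\<not> \<alpha> \<subseteq> \<sigma>"
          using that(1) free[of \<sigma>] by (auto simp: S'_def)
        then show ?thesis
          using down[of \<sigma> \<tau>] that(2) by (auto simp: S'_def)
      qed
      show "\<beta> \<in> S' \<and> (\<exists>v. v \<notin> \<alpha>' \<and> \<beta> = insert v \<alpha>')" if "(\<alpha>', \<beta>) \<in> M'" for \<alpha>' \<beta>
      proof -
        have M: "(\<alpha>', \<beta>) \<in> M" "(\<alpha>', \<beta>) \<noteq> (\<alpha>, insert v \<alpha>)"
          using that by (simp_all add: M'_def)
        then have "\<beta> \<notin> {\<alpha>, insert v \<alpha>}"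
          using uniq[OF M(1) v(2), of \<beta>] by fastforce
        then show ?thesis
          using pairs[OF M(1)] by (simp add: S'_def)
      qed
      show "\<exists>!p. p \<in> M' \<and> (\<sigma> = fst p \<or> \<sigma> = snd p)" if "\<sigma> \<in> S'" for \<sigma>
      proof -
        have \<sigma>: "\<sigma> \<in> S" "\<sigma> \<noteq> \<alpha>" "\<sigma> \<noteq> insert v \<alpha>"
          using that by (simp_all add: S'_def)
        obtain p where p: "p \<in> M" "\<sigma> = fst p \<or> \<sigma> = snd p"
          using ex1[OF \<sigma>(1)] by blast
        have "p \<noteq> (\<alpha>, insert v \<alpha>)"
          using p(2) \<sigma>(2,3) by (metis fst_conv snd_conv)
        show ?thesis
        proof (rule ex1I)
          show "p \<in> M' \<and> (\<sigma> = fst p \<or> \<sigma> = snd p)"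
            using p \<open>p \<noteq> _\<close> by (simp add: M'_def)
          show "q = p" if "q \<in> M' \<and> (\<sigma> = fst q \<or> \<sigma> = snd q)" for q
            using that p by (intro uniq[of q p \<sigma>]) (auto simp: M'_def)
        qed
      qed
      show "acyclic {(\<alpha>', \<alpha>). \<alpha>' \<noteq> \<alpha> \<and> (\<exists>\<beta>'. (\<alpha>', \<beta>') \<in> M') \<and> (\<exists>w. w \<notin> \<alpha>' \<and> (\<alpha>, insert w \<alpha>') \<in> M')}"
        unfolding M'_def by (rule acyclic_subset[OF acyc]) blast
      show "finite S'" "\<And>\<sigma>. \<sigma> \<in> S' \<Longrightarrow> finite \<sigma>"
        using fin by (simp_all add: S'_def)
    qed
    moreover have "geometric_realization S homotopy_equivalent_space geometric_realization S'"
      unfolding S'_def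
    proof (rule elementary_collapse)
      show "finite (\<Union>S)"
        using fin by blast
    qed (fact down False v(1) v(3) free)+
    ultimately show ?thesis
      by (simp add: homotopy_equivalent_space_contractibility)
  qed
qed

section \<open>Quotients by contractible subspaces\<close>

text \<open>Since \<open>g\<close> is constant on \<open>A\<close>, it factors through
  \<open>q\<close> as a map \<open>k\<close> from \<open>Y\<close> back to \<open>X\<close>, the
  homotopy inverse. The homotopy from \<open>id\<close> to \<open>g\<close> keeps \<open>A\<close>
  inside \<open>A\<close> at all times, so it descends to a homotopy from \<open>id\<close> to
  \<open>q \<circ> k\<close>.\<close>

lemma homotopy_equivalent_quotient:
  assumes X: "compact_space X" and Y: "Hausdorff_space Y"
    and q: "continuous_map X Y q" "q ` topspace X = topspace Y"
    and A: "A \<subseteq> topspace X" "\<And>x y. x \<in> A \<Longrightarrow> y \<in> A \<Longrightarrow> q x = q y"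
    and fibre: "\<And>x y. x \<in> topspace X \<Longrightarrow> y \<in> topspace X \<Longrightarrow> q x = q y \<Longrightarrow> x = y \<or> x \<in> A \<and> y \<in> A"
    and G: "homotopic_with (\<lambda>f. f ` A \<subseteq> A) X X id g" and const: "\<And>x. x \<in> A \<Longrightarrow> g x = a"
  shows "X homotopy_equivalent_space Y"
proof -
  let ?I = "top_of_set {0..1::real}"
  obtain h where h: "continuous_map (prod_topology ?I X) X h" "\<And>x. h (0, x) = x" "\<And>x. h (1, x) = g x"
      "\<And>t x. t \<in> {0..1} \<Longrightarrow> x \<in> A \<Longrightarrow> h (t, x) \<in> A"
    using G unfolding homotopic_with_def by (auto simp: image_subset_iff)
  have qX: "q x \<in> topspace Y" if "x \<in> topspace X" for x
    using q(2) that by blast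
  have quot: "quotient_map X Y q"
    using q X Y by (intro continuous_imp_quotient_map)
  have "continuous_map X X g"
    using homotopic_with_imp_continuous_maps[OF G] by simp
  moreover have "g x = g y" if "x \<in> topspace X" "y \<in> topspace X" "q x = q y" for x y
    using fibre[OF that] const by auto
  ultimately obtain k where k: "continuous_map Y X k" "\<And>x. x \<in> topspace X \<Longrightarrow> k (q x) = g x"
    using quotient_map_lift_exists[OF quot] by metis
  define Q where "Q = (\<lambda>(t::real, x). (t, q x))"
  \<comment> \<open>Descending a homotopy requires that \<open>q\<close> times the unit interval is
    a quotient map; compactness and the Hausdorff property give this again.\<close>
  have quotQ: "quotient_map (prod_topology ?I X) (prod_topology ?I Y) Q"
  proof (rule continuous_imp_quotient_map)
    show "continuous_map (prod_topology ?I X) (prod_topology ?I Y) Q"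
      unfolding Q_def using q(1) by (simp add: continuous_map_prod_top)
    show "compact_space (prod_topology ?I X)"
      using X by (simp add: compact_space_prod_topology compact_space_subtopology)
    show "Hausdorff_space (prod_topology ?I Y)"
      using Y by (simp add: Hausdorff_space_prod_topology Hausdorff_space_subtopology)
    show "Q ` topspace (prod_topology ?I X) = topspace (prod_topology ?I Y)"
      using q(2) by (force simp: Q_def)
  qed
  have qh: "continuous_map (prod_topology ?I X) Y (q \<circ> h)"
    using h(1) q(1) by (rule continuous_map_compose)
  have eqQ: "(q \<circ> h) p = (q \<circ> h) p'"
    if p: "p \<in> topspace (prod_topology ?I X)" "p' \<in> topspace (prod_topology ?I X)" "Q p = Q p'" for p p'
  proof -
    obtain t x x' where tx: "p = (t, x)" "p' = (t, x')" "q x = q x'" "t \<in> {0..1}" "x \<in> topspace X" "x' \<in> topspace X"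
      using p by (cases p; cases p') (auto simp: Q_def)
    then consider "x = x'" | "x \<in> A" "x' \<in> A"
      using fibre[OF tx(5,6,3)] by blast
    then show ?thesis
    proof cases
      case 2
      then show ?thesis
        using A(2)[of "h (t, x)" "h (t, x')"] h(4) tx(4) by (simp add: tx(1,2))
    qed (simp add: tx(1,2))
  qed
  have "\<exists>l. continuous_map (prod_topology ?I Y) Y l \<and>
      (\<forall>p \<in> topspace (prod_topology ?I X). l (Q p) = (q \<circ> h) p)"
    by (rule quotient_map_lift_exists[OF quotQ qh eqQ]) auto
  then obtain l where l: "continuous_map (prod_topology ?I Y) Y l"
      "\<forall>p \<in> topspace (prod_topology ?I X). l (Q p) = (q \<circ> h) p"
    by (elim exE conjE)
  have l_eq: "l (t, q x) = q (h (t, x))" if "t \<in> {0..1}" "x \<in> topspace X" for t x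
    using l(2)[rule_format, of "(t, x)"] that by (simp add: Q_def)
  have "homotopic_with (\<lambda>x. True) Y Y id (q \<circ> k)"
  proof (subst homotopic_with, simp, intro exI conjI ballI)
    fix y assume "y \<in> topspace Y"
    then obtain x where x: "x \<in> topspace X" "y = q x"
      using q(2) by blast
    show "l (0, y) = id y" "l (1, y) = (q \<circ> k) y"
      using x by (simp_all add: l_eq h k)
  qed (use l in auto)
  moreover have "homotopic_with (\<lambda>x. True) X X id (k \<circ> q)"
    using homotopic_with_mono[OF G, of "\<lambda>x. True"]
    by (rule homotopic_with_eq) (auto simp: k)
  ultimately show ?thesis
    unfolding homotopy_equivalent_space_def using k(1) q(1) by (meson homotopic_with_sym)
qed

text \<open>If \<open>A\<close> has the neighbourhood \<open>u \<le> 1\<close> that \<open>R\<close> deforms into \<open>A\<close>, a contraction \<open>H\<close> of \<open>A\<close>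
  extends to the map \<open>x \<mapsto> H (1 - u x) (R 1 x)\<close> on that neighbourhood, which is \<open>R 1\<close> on its
  boundary.\<close>

lemma homotopic_id_collapsing:
  assumes A: "A \<subseteq> topspace X" "contractible_space (subtopology X A)"
    and u: "continuous_map X euclideanreal u" "\<And>x. x \<in> topspace X \<Longrightarrow> 0 \<le> u x" "\<And>x. x \<in> A \<Longrightarrow> u x = 0"
    and R: "continuous_map (prod_topology (top_of_set {0..1::real}) X) X R"
      "\<And>x. x \<in> topspace X \<Longrightarrow> R (0, x) = x"
      "\<And>t x. t \<in> {0..1} \<Longrightarrow> x \<in> A \<Longrightarrow> R (t, x) \<in> A"
      "\<And>x. x \<in> topspace X \<Longrightarrow> u x \<le> 1 \<Longrightarrow> R (1, x) \<in> A"
  obtains g a where "homotopic_with (\<lambda>f. f ` A \<subseteq> A) X X id g" "\<And>x. x \<in> A \<Longrightarrow> g x = a"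
proof -
  let ?I = "top_of_set {0..1::real}"
  let ?P = "\<lambda>f. f ` A \<subseteq> A"
  have P: "?P h \<longleftrightarrow> ?P k" if "\<And>x. x \<in> topspace X \<Longrightarrow> h x = k x" for h k
    using that A(1) by (metis image_cong subsetD)
  have hom: "homotopic_with ?P X X p q \<longleftrightarrow>
      (\<exists>h. continuous_map (prod_topology ?I X) X h \<and> (\<forall>x \<in> topspace X. h (0, x) = p x) \<and>
         (\<forall>x \<in> topspace X. h (1, x) = q x) \<and> (\<forall>t \<in> {0..1}. ?P (\<lambda>x. h (t, x))))" for p q
    by (rule homotopic_with) (rule P)
  obtain a H where H: "continuous_map (prod_topology ?I (subtopology X A)) (subtopology X A) H"
      "\<And>x. H (0, x) = x" "\<And>x. H (1, x) = a"
    using A(2) unfolding contractible_space_def homotopic_with_def by auto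
  have HA: "H (t, x) \<in> A" if "t \<in> {0..1}" "x \<in> A" for t x
    using continuous_map_image_subset_topspace[OF H(1)] that A(1) by (auto simp: image_subset_iff)
  define r where "r x = R (1, x)" for x
  \<comment> \<open>On \<open>A\<close>, where \<open>u x = 0\<close>, the time
    \<open>t * (1 - u x)\<close> runs through the whole contraction and ends at \<open>a\<close>.
    The map \<open>r\<close> comes first because \<open>H\<close> contracts \<open>A\<close> only;
    the homotopy \<open>K\<close> therefore starts at \<open>r\<close> and is appended to
    \<open>R\<close>.\<close>
  define K where "K = (\<lambda>(t, x). if u x \<le> 1 then H (t * (1 - u x), r x) else r x)"
  have 1: "homotopic_with ?P X X id r"
  unfolding hom
  proof (intro exI[of _ R] conjI ballI)
    show "(\<lambda>x. R (t, x)) ` A \<subseteq> A" if "t \<in> {0..1}" for t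
      using R(3) that by auto
  qed (use R in \<open>auto simp: r_def\<close>)
  have cont_r: "continuous_map X X r"
    using homotopic_with_imp_continuous_maps[OF 1] by simp
  have "continuous_map (prod_topology ?I X) X (\<lambda>p. if (u \<circ> snd) p \<le> 1
      then H (fst p * (1 - u (snd p)), r (snd p)) else r (snd p))"
  proof (rule continuous_map_cases_le)
    have cu: "continuous_map (prod_topology ?I X) euclideanreal (u \<circ> snd)"
      using continuous_map_snd u(1) by (rule continuous_map_compose)
    then show "continuous_map (prod_topology ?I X) euclideanreal (u \<circ> snd)" .
    have cr: "continuous_map (prod_topology ?I X) X (r \<circ> snd)"
      using continuous_map_snd cont_r by (rule continuous_map_compose)
    let ?S = "{p \<in> topspace (prod_topology ?I X). (u \<circ> snd) p \<le> 1}"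
    show "continuous_map (subtopology (prod_topology ?I X) ?S) X
       (\<lambda>p. H (fst p * (1 - u (snd p)), r (snd p)))"
    proof -
      have "continuous_map (subtopology (prod_topology ?I X) ?S) (prod_topology ?I (subtopology X A))
         (\<lambda>p. (fst p * (1 - u (snd p)), r (snd p)))"
      proof (intro continuous_map_pairedI)
        have "continuous_map (prod_topology ?I X) euclideanreal fst"
          using continuous_map_fst continuous_map_into_fulltopology by blast
        then have "continuous_map (prod_topology ?I X) euclideanreal (\<lambda>p. fst p * (1 - u (snd p)))"
          using cu unfolding o_def by (intro continuous_intros)
        then show "continuous_map (subtopology (prod_topology ?I X) ?S) ?I (\<lambda>p. fst p * (1 - u (snd p)))"
          using u(2) by (auto simp: continuous_map_in_subtopology mult_le_one intro: continuous_map_from_subtopology)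
        show "continuous_map (subtopology (prod_topology ?I X) ?S) (subtopology X A) (\<lambda>p. r (snd p))"
          using cr R(4) unfolding o_def
          by (auto simp: continuous_map_in_subtopology r_def intro: continuous_map_from_subtopology)
      qed
      from continuous_map_compose[OF this H(1)] show ?thesis
        unfolding o_def by (rule continuous_map_into_fulltopology)
    qed
    show "continuous_map (subtopology (prod_topology ?I X) {p \<in> topspace (prod_topology ?I X). 1 \<le> (u \<circ> snd) p}) X
      (\<lambda>p. r (snd p))"
      using cr unfolding o_def by (rule continuous_map_from_subtopology)
  qed (auto simp: H)
  then have "continuous_map (prod_topology ?I X) X K"
    by (simp add: K_def case_prod_beta')
  moreover have "K (t, x) \<in> A" if "t \<in> {0..1}" "x \<in> A" for t x
  proof -
    have "r x \<in> A"
      using R(3)[of 1 x] that by (simp add: r_def)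
    then show ?thesis
      using HA[of t "r x"] u(3)[OF \<open>x \<in> A\<close>] that by (simp add: K_def)
  qed
  moreover have "K (0, x) = r x" for x
    by (simp add: K_def H)
  ultimately have "homotopic_with ?P X X r (\<lambda>x. K (1, x))"
    unfolding hom by (intro exI[of _ K]) auto
  with 1 have "homotopic_with ?P X X id (\<lambda>x. K (1, x))"
    by (rule homotopic_with_trans)
  moreover have "K (1, x) = a" if "x \<in> A" for x
    using u(3)[OF that] by (simp add: K_def H)
  ultimately show ?thesis
    using that by blast
qed

text \<open>The wedge maps continuously and injectively into the product of the spaces: each summand
  goes to its coordinate axis, with base points in all other coordinates. The Hausdorff property
  pulls back along such a map.\<close>

lemma Hausdorff_space_wedge:
  assumes "\<And>i. i \<in> I \<Longrightarrow> Hausdorff_space (X i)" "\<And>i. i \<in> I \<Longrightarrow> b i \<in> topspace (X i)"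
  shows "Hausdorff_space (wedge X b I)"
proof (rule Hausdorff_space_injective_preimage)
  let ?S = "sum_topology X I"
  define \<psi> where "\<psi> z = (case z of None \<Rightarrow> restrict b I | Some (i, y) \<Rightarrow> (\<lambda>j\<in>I. if j = i then y else b j))" for z
  have \<psi>_collapse: "\<psi> (wedge_collapse b (i, y)) = (\<lambda>j\<in>I. if j = i then y else b j)" for i y
    by (auto simp: \<psi>_def wedge_collapse_def)
  show "Hausdorff_space (product_topology X I)"
    using assms(1) by (simp add: Hausdorff_space_product_topology)
  have cont: "continuous_map ?S (product_topology X I) (\<psi> \<circ> wedge_collapse b)"
  proof (rule continuous_map_coordinatewise_then_product)
    fix j assume j: "j \<in> I"
    have "continuous_map ?S (X j) (\<lambda>p. if j = fst p then snd p else b j)"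
      unfolding continuous_map_def
    proof (intro conjI allI impI)
      fix U assume U: "openin (X j) U"
      show "openin ?S {p \<in> topspace ?S. (if j = fst p then snd p else b j) \<in> U}"
        unfolding openin_sum_topology
      proof (intro conjI ballI)
        fix i assume i: "i \<in> I"
        have "{x. (i, x) \<in> {p \<in> topspace ?S. (if j = fst p then snd p else b j) \<in> U}} =
          (if i = j then U else if b j \<in> U then topspace (X i) else {})"
          using i openin_subset[OF U] by auto
        then show "openin (X i) {x. (i, x) \<in> {p \<in> topspace ?S. (if j = fst p then snd p else b j) \<in> U}}"
          using U by simp
      qed auto
    qed (use j assms(2) in auto)
    then show "continuous_map ?S (X j) (\<lambda>p. (\<psi> \<circ> wedge_collapse b) p j)"
      by (rule continuous_map_eq) (use j in \<open>auto simp: \<psi>_collapse\<close>)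
  qed (auto simp: \<psi>_collapse)
  have None: "\<psi> None \<in> topspace (product_topology X I)"
    using assms(2) by (auto simp: \<psi>_def)
  show "continuous_map (wedge X b I) (product_topology X I) \<psi>"
    unfolding continuous_map_def
  proof (intro conjI allI impI)
    show "\<psi> \<in> topspace (wedge X b I) \<rightarrow> topspace (product_topology X I)"
      using None continuous_map_funspace[OF cont] by (auto simp: topspace_wedge Pi_iff)
    fix U assume U: "openin (product_topology X I) U"
    have "{p \<in> topspace ?S. wedge_collapse b p \<in> {z \<in> topspace (wedge X b I). \<psi> z \<in> U}} =
        {p \<in> topspace ?S. (\<psi> \<circ> wedge_collapse b) p \<in> U}"
      unfolding topspace_wedge by auto
    moreover have "openin ?S \<dots>"
      using cont U by (rule openin_continuous_map_preimage)
    moreover have "{z \<in> topspace (wedge X b I). \<psi> z \<in> U} \<subseteq> topspace (wedge X b I)"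
      by blast
    ultimately show "openin (wedge X b I) {z \<in> topspace (wedge X b I). \<psi> z \<in> U}"
      unfolding openin_wedge topspace_wedge[symmetric] by simp
  qed
  show "inj_on \<psi> (topspace (wedge X b I))"
  proof -
    \<comment> \<open>The only coordinate that is not a base point reveals both the summand and the
      point in it.\<close>
    have *: "z = z'" if z: "z \<in> topspace (wedge X b I)" "z' \<in> topspace (wedge X b I)" "\<psi> z = \<psi> z'"
      and "z = Some (i, y)" for z z' i y
    proof -
      have iy: "i \<in> I" "y \<noteq> b i"
        using that by (auto simp: topspace_wedge wedge_collapse_def split: if_splits)
      then have "\<psi> z i = y"
        by (simp add: \<psi>_def \<open>z = _\<close>)
      then have "\<psi> z' i = y"
        by (simp add: z(3))
      then show ?thesis
        using iy z(2) \<open>z = _\<close> by (auto simp: \<psi>_def topspace_wedge split: option.splits if_splits)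
    qed
    show ?thesis
    proof (rule inj_onI)
      fix z z' assume "z \<in> topspace (wedge X b I)" "z' \<in> topspace (wedge X b I)" "\<psi> z = \<psi> z'"
      then show "z = z'"
        using *[of z z'] *[of z' z] by (cases z; cases z') (auto simp: split: prod.splits)
    qed
  qed
qed

section \<open>Collapsing the boundary of a simplex\<close>

text \<open>In the coordinates \<open>w i = y i - y 0\<close>, \<open>1 \<le> i \<le> d\<close>, the open simplex is a neighbourhood of
  the origin on which, with \<open>t = (d + 1) * Min y\<close>, the map \<open>w \<mapsto> u = w / t\<close> is a homeomorphism onto Euclidean space; \<open>stereo\<close> is its
  composition with the inverse stereographic projection \<open>u \<mapsto> (\<bar>u\<bar>\<^sup>2 - 1, 2 u) / (\<bar>u\<bar>\<^sup>2 + 1)\<close>.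
  Clearing the denominator \<open>t\<close> extends it to the boundary, where \<open>t = 0\<close>.\<close>

definition stereo :: "nat \<Rightarrow> (nat \<Rightarrow> real) \<Rightarrow> nat \<Rightarrow> real" where
  "stereo d y =
     (let t = real (Suc d) * Min (y ` {..d});
          W = (\<Sum>i\<le>d. (y i - y 0)\<^sup>2)
      in (\<lambda>i. if i = 0 then (W - t\<^sup>2) / (W + t\<^sup>2)
              else if i \<le> d then 2 * t * (y i - y 0) / (W + t\<^sup>2) else 0))"

text \<open>Both terms vanish only if all coordinates agree and their minimum is 0, which is
  incompatible with the coordinate sum 1.\<close>

lemma stereo_denominator_pos:
  assumes "\<And>i. 0 \<le> y i" "(\<Sum>i\<le>d. y i) = 1"
  shows "0 < (\<Sum>i\<le>d. (y i - y 0)\<^sup>2) + (real (Suc d) * Min (y ` {..d}))\<^sup>2"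
proof -
  have nonneg: "0 \<le> (\<Sum>i\<le>d. (y i - y 0)\<^sup>2)"
    by (simp add: sum_nonneg)
  show ?thesis
  proof (cases "\<forall>i\<le>d. y i = y 0")
    case True
    then have "y ` {..d} = (\<lambda>_. y 0) ` {..d}" "(\<Sum>i\<le>d. y i) = (\<Sum>i\<le>d. y 0)"
      by (intro image_cong sum.cong; blast)+
    then have "y ` {..d} = {y 0}" "real (Suc d) * y 0 = 1"
      using assms(2) by auto
    then show ?thesis
      using nonneg by simp
  next
    case False
    then obtain i where "i \<le> d" "y i \<noteq> y 0"
      by blast
    then have "0 < (\<Sum>i\<le>d. (y i - y 0)\<^sup>2)"
      by (intro sum_pos2[of _ i]) auto
    then show ?thesis
      by (simp add: add_pos_nonneg)
  qed
qed

lemma sum_atMost_remove_0: "(\<Sum>i\<le>d. f i) = f 0 + (\<Sum>i\<in>{..d} - {0}. f i)" for f :: "nat \<Rightarrow> real"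
  by (rule sum.remove) auto

lemma stereo_norm:
  assumes "\<And>i. 0 \<le> y i" "(\<Sum>i\<le>d. y i) = 1"
  shows "(\<Sum>i\<le>d. (stereo d y i)\<^sup>2) = 1"
proof -
  define t where "t = real (Suc d) * Min (y ` {..d})"
  define W where "W = (\<Sum>i\<le>d. (y i - y 0)\<^sup>2)"
  have pos: "0 < W + t\<^sup>2"
    unfolding W_def t_def by (rule stereo_denominator_pos[OF assms])
  have st: "stereo d y i = (if i = 0 then (W - t\<^sup>2) / (W + t\<^sup>2)
              else if i \<le> d then 2 * t * (y i - y 0) / (W + t\<^sup>2) else 0)" for i
    by (simp add: stereo_def Let_def t_def W_def)
  have "(\<Sum>i\<le>d. (stereo d y i)\<^sup>2) = (stereo d y 0)\<^sup>2 + (\<Sum>i\<in>{..d} - {0}. (stereo d y i)\<^sup>2)"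
    by (rule sum_atMost_remove_0)
  also have "(\<Sum>i\<in>{..d} - {0}. (stereo d y i)\<^sup>2) = (\<Sum>i\<in>{..d} - {0}. (2 * t / (W + t\<^sup>2))\<^sup>2 * (y i - y 0)\<^sup>2)"
    by (intro sum.cong) (auto simp: st power_mult_distrib power_divide)
  also have "\<dots> = (2 * t / (W + t\<^sup>2))\<^sup>2 * W"
    by (simp add: W_def sum_distrib_left sum_atMost_remove_0)
  also have "(stereo d y 0)\<^sup>2 + (2 * t / (W + t\<^sup>2))\<^sup>2 * W = ((W - t\<^sup>2)\<^sup>2 + 4 * t\<^sup>2 * W) / (W + t\<^sup>2)\<^sup>2"
    by (simp add: st power_divide power_mult_distrib add_divide_distrib)
  also have "(W - t\<^sup>2)\<^sup>2 + 4 * t\<^sup>2 * W = (W + t\<^sup>2)\<^sup>2"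
    by (simp add: power2_eq_square algebra_simps)
  finally show ?thesis
    using pos by simp
qed

lemma stereo_boundary:
  assumes "\<And>i. 0 \<le> y i" "(\<Sum>i\<le>d. y i) = 1" "Min (y ` {..d}) = 0"
  shows "stereo d y = (\<lambda>i. if i = 0 then 1 else 0)"
  using stereo_denominator_pos[OF assms(1,2)] assms(3) by (auto simp: stereo_def Let_def)

lemma stereo_interior:
  assumes "\<And>i. 0 \<le> y i" "(\<Sum>i\<le>d. y i) = 1" "0 < Min (y ` {..d})"
  shows "stereo d y 0 < 1"
proof -
  have "0 < (real (Suc d) * Min (y ` {..d}))\<^sup>2"
    using assms(3) by (intro zero_less_power mult_pos_pos) auto
  then show ?thesis
    using stereo_denominator_pos[OF assms(1,2)] by (simp add: stereo_def Let_def divide_less_eq)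
qed

text \<open>Equal images mean equal quotients \<open>w / t\<close>, so \<open>w\<close> and
  \<open>t\<close> are scaled by one factor \<open>\<kappa>\<close>, and so are the excesses
  \<open>y i - m\<close> over the minimum. These sum to \<open>1 - t\<close>, because
  \<open>t\<close> is \<open>d + 1\<close> times the minimum. Hence
  \<open>1 - \<kappa> * t = \<kappa> * (1 - t)\<close>, which forces
  \<open>\<kappa> = 1\<close>.\<close>

lemma stereo_inj:
  assumes y: "\<And>i. 0 \<le> y i" "(\<Sum>i\<le>d. y i) = 1" "0 < Min (y ` {..d})"
    and y': "\<And>i. 0 \<le> y' i" "(\<Sum>i\<le>d. y' i) = 1" "0 < Min (y' ` {..d})"
    and eq: "stereo d y = stereo d y'" and i: "i \<le> d"
  shows "y i = y' i"
proof -
  define m m' where "m = Min (y ` {..d})" and "m' = Min (y' ` {..d})"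
  define t t' where "t = real (Suc d) * m" and "t' = real (Suc d) * m'"
  define Q Q' where "Q = (\<Sum>i\<le>d. (y i - y 0)\<^sup>2) + t\<^sup>2" and "Q' = (\<Sum>i\<le>d. (y' i - y' 0)\<^sup>2) + t'\<^sup>2"
  define \<kappa> where "\<kappa> = (t / Q) / (t' / Q')"
  have pos: "0 < t" "0 < t'" "0 < Q" "0 < Q'"
    using y(3) y'(3) stereo_denominator_pos[OF y(1,2)] stereo_denominator_pos[OF y'(1,2)]
    by (simp_all add: t_def t'_def m_def m'_def Q_def Q'_def)
  then have "0 < \<kappa>"
    by (simp add: \<kappa>_def)
  have st: "stereo d y 0 = (Q - 2 * t\<^sup>2) / Q" "\<And>i. 0 < i \<Longrightarrow> i \<le> d \<Longrightarrow> stereo d y i = 2 * t * (y i - y 0) / Q"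
    and st': "stereo d y' 0 = (Q' - 2 * t'\<^sup>2) / Q'" "\<And>i. 0 < i \<Longrightarrow> i \<le> d \<Longrightarrow> stereo d y' i = 2 * t' * (y' i - y' 0) / Q'"
    by (simp_all add: stereo_def Let_def t_def t'_def m_def m'_def Q_def Q'_def)
  have "1 - 2 * t\<^sup>2 / Q = 1 - 2 * t'\<^sup>2 / Q'"
    using st(1) st'(1) pos by (simp add: eq diff_divide_distrib)
  then have "t' = \<kappa> * t"
    using pos by (simp add: \<kappa>_def field_simps power2_eq_square)
  moreover have w: "y' i - y' 0 = \<kappa> * (y i - y 0)" if "i \<le> d" for i
  proof (cases "i = 0")
    case False
    then have "2 * t * (y i - y 0) / Q = 2 * t' * (y' i - y' 0) / Q'"
      using st(2)[of i] st'(2)[of i] that by (simp add: eq)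
    then show ?thesis
      using pos by (simp add: \<kappa>_def field_simps)
  qed simp
  have m_le: "m \<le> y i" "m' \<le> y' i" if "i \<le> d" for i
    using that by (simp_all add: m_def m'_def)
  have "m \<in> y ` {..d}" "m' \<in> y' ` {..d}"
    unfolding m_def m'_def by (intro Min_in; simp)+
  then obtain j j' where j: "j \<le> d" "y j = m" and j': "j' \<le> d" "y' j' = m'"
    by auto
  \<comment> \<open>The offset \<open>y 0 - m\<close> is the negative of the least difference
    \<open>y i - y 0\<close>, so the positive factor \<open>\<kappa>\<close> scales it too.\<close>
  have c: "y' 0 - m' = \<kappa> * (y 0 - m)"
  proof (rule antisym)
    have "y' 0 - m' = - (\<kappa> * (y j' - y 0))"
      using w[OF j'(1)] j'(2) by simp
    also have "\<dots> = \<kappa> * (y 0 - y j')"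
      by (simp add: algebra_simps)
    also have "\<dots> \<le> \<kappa> * (y 0 - m)"
      using m_le(1)[OF j'(1)] \<open>0 < \<kappa>\<close> by simp
    finally show "y' 0 - m' \<le> \<kappa> * (y 0 - m)" .
    have "\<kappa> * (y 0 - m) = - (y' j - y' 0)"
      using w[OF j(1)] j(2) by (simp add: algebra_simps)
    also have "\<dots> \<le> y' 0 - m'"
      using m_le(2)[OF j(1)] by simp
    finally show "\<kappa> * (y 0 - m) \<le> y' 0 - m'" .
  qed
  have "y' i - m' = \<kappa> * (y i - m)" if "i \<le> d" for i
    using w[OF that] c by (simp add: algebra_simps)
  then have "(\<Sum>i\<le>d. y' i - m') = (\<Sum>i\<le>d. \<kappa> * (y i - m))"
    by (intro sum.cong) auto
  then have "1 - t' = \<kappa> * (1 - t)"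
    using y(2) y'(2) by (simp add: sum_subtractf t_def t'_def flip: sum_distrib_left)
  ultimately have "\<kappa> = 1"
    by (simp add: algebra_simps)
  moreover from this have "m' = m"
    using \<open>t' = \<kappa> * t\<close> by (simp add: t_def t'_def)
  ultimately show ?thesis
    using w[OF i] c by simp
qed

text \<open>The preimage is explicit: stereographic projection from the base point gives
  \<open>u\<close>, and a point of the open simplex with \<open>w = t * u\<close> is then determined
  by its scale \<open>t\<close>.\<close>

lemma stereo_surj:
  assumes z: "(\<Sum>i\<le>d. (z i)\<^sup>2) = 1" "\<And>i. d < i \<Longrightarrow> z i = 0" "z \<noteq> (\<lambda>i. if i = 0 then 1 else 0)"
  obtains y where "\<forall>i. 0 \<le> y i" "(\<Sum>i\<le>d. y i) = 1" "0 < Min (y ` {..d})" "stereo d y = z"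
proof -
  note split = sum_atMost_remove_0[of _ d]
  have z0: "z 0 < 1"
  proof (rule ccontr)
    assume "\<not> z 0 < 1"
    then have "1 \<le> (z 0)\<^sup>2"
      by (simp add: one_le_power)
    then have "(\<Sum>i\<in>{..d} - {0}. (z i)\<^sup>2) \<le> 0"
      using z(1) by (simp add: split)
    then have 0: "(\<Sum>i\<in>{..d} - {0}. (z i)\<^sup>2) = 0"
      by (simp add: order_antisym sum_nonneg)
    then have "z i = 0" if "i \<noteq> 0" for i
      using that z(2)[of i] by (cases "i \<le> d") (auto simp: sum_nonneg_eq_0_iff)
    moreover have "z 0 = 1"
      using z(1) 0 \<open>\<not> z 0 < 1\<close> by (auto simp: split power2_eq_1_iff)
    ultimately show False
      using z(3) by auto
  qed
  define u where "u i = (if i = 0 then 0 else z i / (1 - z 0))" for i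
  define \<mu> where "\<mu> = Min (u ` {..d})"
  define G where "G = (\<Sum>i\<le>d. u i - \<mu>)"
  \<comment> \<open>The excesses of \<open>y\<close> over its minimum sum to \<open>t * G\<close>,
    and the common minimum \<open>t / (d + 1)\<close> contributes another \<open>t\<close>. The
    coordinate sum 1 fixes \<open>t\<close>.\<close>
  define t where "t = 1 / (1 + G)"
  define U where "U = (\<Sum>i\<le>d. (u i)\<^sup>2)"
  define y where "y i = (if i \<le> d then t * (u i - \<mu>) + t / real (Suc d) else 0)" for i
  have \<mu>: "\<mu> \<le> u i" if "i \<le> d" for i
    using that by (simp add: \<mu>_def)
  have "0 \<le> G"
    using \<mu> by (auto simp: G_def intro: sum_nonneg)
  then have t: "0 < t" "t * G + t = 1"
    using distrib_left[of t G 1] by (simp_all add: t_def add.commute)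
  have "0 \<le> U"
    by (simp add: U_def sum_nonneg)
  have "U = (\<Sum>i\<in>{..d} - {0}. (u i)\<^sup>2)"
    by (simp add: U_def split u_def)
  then have "(1 - z 0)\<^sup>2 * U = (\<Sum>i\<in>{..d} - {0}. (1 - z 0)\<^sup>2 * (u i)\<^sup>2)"
    by (simp add: sum_distrib_left)
  also have "\<dots> = (\<Sum>i\<in>{..d} - {0}. (z i)\<^sup>2)"
    using z0 by (intro sum.cong) (auto simp: u_def power_divide)
  also have "\<dots> = (1 - z 0) * (1 + z 0)"
    using z(1) by (simp add: split power2_eq_square algebra_simps)
  finally have "(1 - z 0) * ((1 - z 0) * U) = (1 - z 0) * (1 + z 0)"
    by (simp add: power2_eq_square mult.assoc)
  \<comment> \<open>For \<open>z\<close> on the unit sphere, the squared length of \<open>u\<close>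
    is \<open>(1 + z 0) / (1 - z 0)\<close>.\<close>
  then have U: "(1 - z 0) * U = 1 + z 0"
    using z0 by simp
  have Min_y: "Min (y ` {..d}) = t / real (Suc d)"
  proof (rule Min_eqI)
    have "\<mu> \<in> u ` {..d}"
      unfolding \<mu>_def by (intro Min_in) auto
    then obtain i where "i \<le> d" "u i = \<mu>"
      by auto
    then show "t / real (Suc d) \<in> y ` {..d}"
      by (intro image_eqI[of _ _ i]) (auto simp: y_def)
    show "t / real (Suc d) \<le> v" if "v \<in> y ` {..d}" for v
      using that t \<mu> by (auto simp: y_def)
  qed simp
  have w: "y i - y 0 = t * u i" if "i \<le> d" for i
    using that by (simp add: y_def u_def algebra_simps)
  have "(\<Sum>i\<le>d. (y i - y 0)\<^sup>2) = t\<^sup>2 * U"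
    using w by (simp add: U_def sum_distrib_left power_mult_distrib)
  then have st: "stereo d y i = (if i = 0 then (t\<^sup>2 * U - t\<^sup>2) / (t\<^sup>2 * U + t\<^sup>2)
              else if i \<le> d then 2 * t * (t * u i) / (t\<^sup>2 * U + t\<^sup>2) else 0)" for i
    by (simp add: stereo_def Let_def Min_y w)
  have st0: "(t\<^sup>2 * U - t\<^sup>2) / (t\<^sup>2 * U + t\<^sup>2) = z 0"
  proof -
    have "(t\<^sup>2 * U - t\<^sup>2) / (t\<^sup>2 * U + t\<^sup>2) = (t\<^sup>2 * (U - 1)) / (t\<^sup>2 * (U + 1))"
      by (simp add: algebra_simps)
    also have "\<dots> = (U - 1) / (U + 1)"
      using t(1) by simp
    also have "\<dots> = z 0"
      using U \<open>0 \<le> U\<close> by (simp add: field_simps)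
    finally show ?thesis .
  qed
  have st1: "2 * t * (t * u i) / (t\<^sup>2 * U + t\<^sup>2) = z i" if "i \<noteq> 0" for i
  proof -
    have "2 * t * (t * u i) / (t\<^sup>2 * U + t\<^sup>2) = (t\<^sup>2 * (2 * u i)) / (t\<^sup>2 * (U + 1))"
      by (simp add: algebra_simps power2_eq_square)
    also have "\<dots> = 2 * u i / (U + 1)"
      using t(1) by simp
    also have "\<dots> = 2 * z i / ((1 - z 0) * U + (1 - z 0))"
      using that z0 by (simp add: u_def algebra_simps)
    also have "\<dots> = z i"
      by (simp add: U)
    finally show ?thesis .
  qed
  show thesis
  proof (rule that)
    show "\<forall>i. 0 \<le> y i"
      using t \<mu> by (simp add: y_def)
    have "(\<Sum>i\<le>d. y i) = (\<Sum>i\<le>d. t * (u i - \<mu>) + t / real (Suc d))"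
      by (intro sum.cong) (auto simp: y_def)
    also have "\<dots> = t * G + t"
      by (simp add: sum.distrib G_def flip: sum_distrib_left)
    finally show "(\<Sum>i\<le>d. y i) = 1"
      using t by simp
    show "0 < Min (y ` {..d})"
      using t by (simp add: Min_y)
    show "stereo d y = z"
      using st0 st1 z(2) by (auto simp: st fun_eq_iff)
  qed
qed

lemma stereo_cong:
  assumes "\<And>j. j \<le> d \<Longrightarrow> y j = y' j"
  shows "stereo d y = stereo d y'"
proof -
  have "y ` {..d} = y' ` {..d}" "(\<Sum>j\<le>d. (y j - y 0)\<^sup>2) = (\<Sum>j\<le>d. (y' j - y' 0)\<^sup>2)"
    using assms by (auto intro!: image_cong sum.cong)
  then show ?thesis
    using assms by (auto simp: stereo_def Let_def fun_eq_iff)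
qed

section \<open>Complexes that are contractible up to facets\<close>

text \<open>The realization is a finite union of closed simplices, each cut out by the closed
  condition of coordinate sum 1 from a product of copies of \<open>{0..1}\<close> and
  \<open>{0}\<close>. Such a product is compact even if the vertex type is infinite.\<close>

lemma compact_realization_points:
  fixes S :: "'v set set"
  assumes "finite S" "\<And>\<sigma>. \<sigma> \<in> S \<Longrightarrow> finite \<sigma>" "\<And>\<sigma> \<tau>. \<sigma> \<in> S \<Longrightarrow> \<tau> \<subseteq> \<sigma> \<Longrightarrow> \<tau> \<in> S"
  shows "compact (realization_points S)"
proof -
  define B where "B \<sigma> = PiE UNIV (\<lambda>v. if v \<in> \<sigma> then {0..1::real} else {0})" for \<sigma> :: "'v set"
  have "compact (B \<sigma> \<inter> {x. sum x \<sigma> = 1})" for \<sigma>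
  proof (rule compact_Int_closed)
    have "compactin (powertop_real UNIV) (B \<sigma>)"
      unfolding B_def by (simp add: compactin_PiE)
    then show "compact (B \<sigma>)"
      by (simp add: euclidean_product_topology)
    have "continuous_on UNIV (\<lambda>x. \<Sum>v\<in>\<sigma>. x v :: real)"
      by (intro continuous_on_sum) simp
    from closed_Collect_eq[OF this continuous_on_const]
    show "closed {x. sum x \<sigma> = (1 :: real)}" .
  qed
  then have "compact (\<Union>\<sigma>\<in>S. B \<sigma> \<inter> {x. sum x \<sigma> = 1})"
    using assms(1) by (intro compact_UN)
  moreover have "realization_points S = (\<Union>\<sigma>\<in>S. B \<sigma> \<inter> {x. sum x \<sigma> = 1})"
  proof (intro equalityI subsetI)
    fix x assume x: "x \<in> realization_points S"
    define \<sigma> where "\<sigma> = {v. x v \<noteq> 0}"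
    have \<sigma>: "\<sigma> \<in> S" "sum x \<sigma> = 1" "\<And>v. 0 \<le> x v"
      using x by (auto simp: realization_points_def \<sigma>_def)
    then have "x v \<le> 1" if "v \<in> \<sigma>" for v
      using member_le_sum[of v \<sigma> x] assms(2) that by simp
    then have "x \<in> B \<sigma>"
      using \<sigma> by (auto simp: B_def \<sigma>_def)
    then show "x \<in> (\<Union>\<sigma>\<in>S. B \<sigma> \<inter> {x. sum x \<sigma> = 1})"
      using \<sigma> by blast
  next
    fix x assume "x \<in> (\<Union>\<sigma>\<in>S. B \<sigma> \<inter> {x. sum x \<sigma> = 1})"
    then obtain \<sigma> where \<sigma>: "\<sigma> \<in> S" "x \<in> B \<sigma>" "sum x \<sigma> = 1"
      by blast
    have "x v \<in> (if v \<in> \<sigma> then {0..1} else {0})" for v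
      using \<sigma>(2) by (auto simp: B_def PiE_def Pi_def)
    then have "0 \<le> x v" "v \<notin> \<sigma> \<Longrightarrow> x v = 0" for v
      by (metis atLeastAtMost_iff order_refl singletonD)+
    then have nn: "\<And>v. 0 \<le> x v" and supp: "{v. x v \<noteq> 0} \<subseteq> \<sigma>"
      by blast+
    then have "(\<Sum>v | x v \<noteq> 0. x v) = sum x \<sigma>"
      using assms(2)[OF \<sigma>(1)] by (intro sum.mono_neutral_left) auto
    then show "x \<in> realization_points S"
      using nn assms(3)[OF \<sigma>(1) supp] \<sigma>(3) by (simp add: realization_points_def)
  qed
  ultimately show ?thesis
    by simp
qed

text \<open>Cutting off small coordinates and renormalizing preserves every subcomplex, and at time 1 it
  pushes all points that have a small nonzero coordinate into a proper face.\<close>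

definition shrink :: "'v set \<Rightarrow> real \<times> ('v \<Rightarrow> real) \<Rightarrow> 'v \<Rightarrow> real" where
  "shrink V = (\<lambda>(s, x) w. max (x w - s / (2 * real (card V))) 0 /
     (\<Sum>v\<in>V. max (x v - s / (2 * real (card V))) 0))"

text \<open>The constant 2 is chosen for this bound: at time 1 each of the \<open>card V\<close>
  coordinates loses at most \<open>1 / (2 * card V)\<close>, so at least half of the mass
  survives.\<close>

lemma shrink_denominator_pos:
  assumes "finite V" "sum x V = 1" "s \<in> {0..1}"
  shows "0 < (\<Sum>v\<in>V. max (x v - s / (2 * real (card V))) 0)"
proof -
  have "card V \<noteq> 0"
    using assms(1,2) by auto
  then have "(\<Sum>v\<in>V. x v - s / (2 * real (card V))) = 1 - s / 2"
    using assms(2) by (simp add: sum_subtractf)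
  moreover have "(\<Sum>v\<in>V. x v - s / (2 * real (card V))) \<le> (\<Sum>v\<in>V. max (x v - s / (2 * real (card V))) 0)"
    by (intro sum_mono) simp
  ultimately show ?thesis
    using assms(3) by simp
qed

lemma shrink_support:
  assumes "finite V" "sum x V = 1" "s \<in> {0..1}"
  shows "{w. shrink V (s, x) w \<noteq> 0} = {w. s / (2 * real (card V)) < x w}"
proof (rule Collect_cong)
  fix w
  define c where "c = s / (2 * real (card V))"
  define q where "q = (\<Sum>v\<in>V. max (x v - c) 0)"
  have "0 < q"
    unfolding q_def c_def by (rule shrink_denominator_pos[OF assms])
  moreover have "shrink V (s, x) w = max (x w - c) 0 / q"
    by (simp add: shrink_def c_def q_def)
  ultimately show "shrink V (s, x) w \<noteq> 0 \<longleftrightarrow> s / (2 * real (card V)) < x w"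
    by (simp add: max_def flip: c_def)
qed

lemma shrink_in:
  assumes "finite V" "\<Union>S \<subseteq> V" "\<And>\<sigma> \<tau>. \<sigma> \<in> S \<Longrightarrow> \<tau> \<subseteq> \<sigma> \<Longrightarrow> \<tau> \<in> S"
    and x: "x \<in> realization_points S" and s: "s \<in> {0..1}"
  shows "shrink V (s, x) \<in> realization_points S"
proof -
  note xx = x[unfolded realization_points_iff[OF assms(1,2)]]
  note pos = shrink_denominator_pos[OF assms(1) _ s, of x]
  have "{w. shrink V (s, x) w \<noteq> 0} \<subseteq> {v. x v \<noteq> 0}"
  proof -
    have "0 \<le> s / (2 * real (card V))"
      using s by simp
    then show ?thesis
      using xx by (subst shrink_support[OF assms(1) _ s]) auto
  qed
  then have "{w. shrink V (s, x) w \<noteq> 0} \<in> S"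
    using assms(3) xx by blast
  moreover have "0 \<le> shrink V (s, x) w" for w
    using pos xx by (simp add: shrink_def)
  moreover have "sum (shrink V (s, x)) V = 1"
    using pos xx by (simp add: shrink_def flip: sum_divide_distrib)
  ultimately show ?thesis
    by (simp add: realization_points_iff[OF assms(1,2)])
qed

lemma shrink_0:
  assumes "finite V" "\<Union>S \<subseteq> V" "x \<in> realization_points S"
  shows "shrink V (0, x) = x"
proof -
  have x: "\<And>v. 0 \<le> x v" "sum x V = 1"
    using assms by (auto simp: realization_points_iff)
  then show ?thesis
    by (simp add: shrink_def max_absorb1)
qed

lemma continuous_on_shrink:
  assumes "finite V" "\<Union>S \<subseteq> V"
  shows "continuous_on ({0..1} \<times> realization_points S) (shrink V)"
proof -
  define c where "c = inverse (2 * real (card V))"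
  define A where "A = {0..1::real} \<times> realization_points S"
  have max: "continuous_on A (\<lambda>p. max (snd p v - fst p * c) 0)" for v
    by (intro continuous_on_max continuous_on_diff continuous_on_snd_coordinate continuous_on_mult
        continuous_on_const continuous_on_fst continuous_on_id)
  have "0 < (\<Sum>v\<in>V. max (snd p v - fst p * c) 0)" if "p \<in> A" for p
  proof -
    have "sum (snd p) V = 1" "fst p \<in> {0..1}"
      using that realization_points_iff[OF assms, of "snd p"] by (auto simp: A_def)
    from shrink_denominator_pos[OF assms(1) this] show ?thesis
      by (simp only: c_def divide_inverse)
  qed
  then have "continuous_on A (\<lambda>p. max (snd p w - fst p * c) 0 / (\<Sum>v\<in>V. max (snd p v - fst p * c) 0))" for w
    by (intro continuous_on_divide continuous_on_sum max ballI) (metis less_irrefl)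
  then have "continuous_on A (\<lambda>p w. max (snd p w - fst p * c) 0 / (\<Sum>v\<in>V. max (snd p v - fst p * c) 0))"
    by (rule continuous_on_coordinatewise_then_product)
  moreover have "shrink V = (\<lambda>p w. max (snd p w - fst p * c) 0 / (\<Sum>v\<in>V. max (snd p v - fst p * c) 0))"
    by (simp only: shrink_def c_def divide_inverse case_prod_beta')
  ultimately show ?thesis
    by (simp only: A_def)
qed

lemma continuous_on_stereo:
  fixes y :: "'a::topological_space \<Rightarrow> nat \<Rightarrow> real"
  assumes "\<And>i. continuous_on A (\<lambda>x. y x i)"
    and "\<And>x i. x \<in> A \<Longrightarrow> 0 \<le> y x i" "\<And>x. x \<in> A \<Longrightarrow> (\<Sum>i\<le>d. y x i) = 1"
  shows "continuous_on A (\<lambda>x. stereo d (y x))"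
proof (rule continuous_on_coordinatewise_then_product)
  fix i
  have M: "continuous_on A (\<lambda>x. Min (y x ` {..d}))"
    using assms(1) by (intro continuous_on_Min) auto
  have ne: "(\<Sum>i\<le>d. (y x i - y x 0)\<^sup>2) + (real (Suc d) * Min (y x ` {..d}))\<^sup>2 \<noteq> 0" if "x \<in> A" for x
    using stereo_denominator_pos[of "y x" d] assms(2,3)[OF that] by simp
  note cont = continuous_on_divide continuous_on_mult continuous_on_diff continuous_on_add continuous_on_sum
    continuous_on_power continuous_on_const assms(1) M
  show "continuous_on A (\<lambda>x. stereo d (y x) i)"
  proof (cases "i = 0 \<or> d < i")
    case True
    then show ?thesis
      using ne by (auto simp: stereo_def Let_def simp del: of_nat_Suc intro!: cont)
  next
    case False
    then show ?thesis
      using ne by (simp add: stereo_def Let_def del: of_nat_Suc) (intro cont; simp)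
  qed
qed

lemma nsphere_base: "(\<lambda>k. if k = 0 then 1 else 0) \<in> topspace (nsphere d)"
  by (simp add: nsphere sum_atMost_remove_0)

text \<open>The assumption \<open>vertex\<close> excludes an empty realization of
  \<open>S - C\<close>, which would also count as contractible. If \<open>d = 0\<close> and every
  vertex were in \<open>C\<close>, the realization would have \<open>card C\<close> points and the
  wedge one more.\<close>

locale facet_wedge =
  fixes S C :: "'v set set" and d :: nat
  assumes finite_S: "finite S" and finite_simplex: "\<And>\<sigma>. \<sigma> \<in> S \<Longrightarrow> finite \<sigma>"
    and down: "\<And>\<sigma> \<tau>. \<sigma> \<in> S \<Longrightarrow> \<tau> \<subseteq> \<sigma> \<Longrightarrow> \<tau> \<in> S"
    and C_sub: "C \<subseteq> S" and card_C: "\<And>\<sigma>. \<sigma> \<in> C \<Longrightarrow> card \<sigma> = Suc d"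
    and maximal: "\<And>\<sigma> \<tau>. \<sigma> \<in> C \<Longrightarrow> \<tau> \<in> S \<Longrightarrow> \<sigma> \<subseteq> \<tau> \<Longrightarrow> \<tau> = \<sigma>"
    and contractible: "contractible_space (geometric_realization (S - C))"
    and vertex: "\<exists>v. {v} \<in> S - C"
begin

abbreviation "X \<equiv> realization_points S"
abbreviation "A \<equiv> realization_points (S - C)"
abbreviation (input) "base \<equiv> (\<lambda>k::nat. if k = 0 then 1 else 0 :: real)"
abbreviation "supp x \<equiv> {v. x v \<noteq> 0}"

lemma finite_C: "finite C"
  using C_sub finite_S finite_subset by blast

lemma finite_facet: "\<sigma> \<in> C \<Longrightarrow> finite \<sigma>" "\<sigma> \<in> C \<Longrightarrow> \<sigma> \<noteq> {}"
  using C_sub finite_simplex card_C[of \<sigma>] by auto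

lemma A_sub: "A \<subseteq> X"
  by (rule realization_points_mono) blast

lemma in_A_iff: "x \<in> X \<Longrightarrow> x \<in> A \<longleftrightarrow> supp x \<notin> C"
  by (auto simp: realization_points_def)

lemma down_noncritical: "\<sigma> \<in> S - C \<Longrightarrow> \<tau> \<subseteq> \<sigma> \<Longrightarrow> \<tau> \<in> S - C"
  using down[of \<sigma> \<tau>] maximal[of \<tau> \<sigma>] by auto

definition V :: "'v set" where "V = \<Union>S"

lemma V: "finite V" "\<Union>S \<subseteq> V" "\<Union>(S - C) \<subseteq> V" "V \<noteq> {}"
  using finite_S finite_simplex vertex by (auto simp: V_def)

lemma closedin_subcomplex:
  assumes "T \<subseteq> S" "\<And>\<sigma> \<tau>. \<sigma> \<in> T \<Longrightarrow> \<tau> \<subseteq> \<sigma> \<Longrightarrow> \<tau> \<in> T"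
  shows "closedin (top_of_set X) (realization_points T)"
proof (rule compactin_imp_closedin)
  have "Hausdorff_space (powertop_real (UNIV :: 'v set))"
    by (simp add: Hausdorff_space_product_topology)
  then show "Hausdorff_space (top_of_set X)"
    unfolding euclidean_product_topology by (rule Hausdorff_space_subtopology)
  have "compact (realization_points T)"
    using assms finite_subset[OF assms(1) finite_S] finite_simplex
    by (intro compact_realization_points) blast+
  then show "compactin (top_of_set X) (realization_points T)"
    using realization_points_mono[OF assms(1)] by (simp add: compactin_subtopology)
qed

lemma X_nonneg: "x \<in> X \<Longrightarrow> 0 \<le> x v"
  by (simp add: realization_points_def)

lemma sum_X:
  assumes "x \<in> X" "supp x \<subseteq> \<sigma>" "finite \<sigma>"
  shows "sum x \<sigma> = 1"
proof -
  have "sum x (supp x) = sum x \<sigma>"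
    using assms(2,3) by (intro sum.mono_neutral_left) auto
  then show ?thesis
    using assms(1) by (simp add: realization_points_def)
qed

text \<open>A point of \<open>A\<close> has no facet of \<open>C\<close> in its support, so all
  minima in \<open>u\<close> vanish there. The factor \<open>2 * card V\<close> matches the
  threshold of \<open>shrink\<close>: if \<open>u x \<le> 1\<close>, every facet of \<open>C\<close>
  has a coordinate of at most \<open>1 / (2 * card V)\<close>, and \<open>shrink\<close> at time 1
  kills it.\<close>

lemma collapsing_map:
  obtains g a where "homotopic_with (\<lambda>f. f ` A \<subseteq> A) (top_of_set X) (top_of_set X) id g"
    "\<forall>x\<in>A. g x = a"
proof (rule homotopic_id_collapsing[where X = "top_of_set X" and A = A
      and u = "\<lambda>x. (\<Sum>\<sigma>\<in>C. Min (x ` \<sigma>)) * (2 * real (card V))" and R = "shrink V"])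
  have Min_nonneg: "0 \<le> Min (x ` \<sigma>)" "0 < Min (x ` \<sigma>) \<longleftrightarrow> \<sigma> \<subseteq> supp x" if "x \<in> X" "\<sigma> \<in> C" for x \<sigma>
    using Min_coordinates_nonneg[OF finite_facet[OF that(2)] X_nonneg[OF that(1)]] by auto
  have cardV: "0 < 2 * real (card V)"
    using V by (simp add: card_gt_0_iff)
  show "A \<subseteq> topspace (top_of_set X)"
    using A_sub by simp
  show "contractible_space (subtopology (top_of_set X) A)"
    using contractible A_sub by (simp add: geometric_realization_eq subtopology_subtopology inf_absorb2)
  have "continuous_on X (\<lambda>x. Min (x ` \<sigma>))" if "\<sigma> \<in> C" for \<sigma>
    using finite_facet[OF that] continuous_on_coordinate
    by (rule continuous_on_Min)
  then have "continuous_on X (\<lambda>x. (\<Sum>\<sigma>\<in>C. Min (x ` \<sigma>)) * (2 * real (card V)))"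
    by (intro continuous_on_mult continuous_on_sum continuous_on_const)
  then show "continuous_map (top_of_set X) euclideanreal (\<lambda>x. (\<Sum>\<sigma>\<in>C. Min (x ` \<sigma>)) * (2 * real (card V)))"
    by simp
  show "0 \<le> (\<Sum>\<sigma>\<in>C. Min (x ` \<sigma>)) * (2 * real (card V))" if "x \<in> topspace (top_of_set X)" for x
    using that Min_nonneg by (intro mult_nonneg_nonneg sum_nonneg) auto
  show "(\<Sum>\<sigma>\<in>C. Min (x ` \<sigma>)) * (2 * real (card V)) = 0" if x: "x \<in> A" for x
  proof -
    have "Min (x ` \<sigma>) = 0" if \<sigma>: "\<sigma> \<in> C" for \<sigma>
    proof (rule ccontr)
      assume "Min (x ` \<sigma>) \<noteq> 0"
      moreover have "x \<in> X" "supp x \<in> S" "supp x \<notin> C"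
        using x A_sub by (auto simp: realization_points_def)
      ultimately have "\<sigma> \<subseteq> supp x"
        using Min_nonneg[of x \<sigma>] \<sigma> by auto
      then have "supp x = \<sigma>"
        using maximal[OF \<sigma> \<open>supp x \<in> S\<close>] by blast
      then show False
        using \<sigma> \<open>supp x \<notin> C\<close> by simp
    qed
    then show ?thesis
      by simp
  qed
  have shrink_X: "shrink V (t, x) \<in> X" if "t \<in> {0..1}" "x \<in> X" for t x
    using shrink_in[OF V(1,2) down that(2,1)] .
  show "continuous_map (prod_topology (top_of_set {0..1}) (top_of_set X)) (top_of_set X) (shrink V)"
    using continuous_on_shrink[OF V(1,2)] shrink_X by auto
  show "shrink V (0, x) = x" if "x \<in> topspace (top_of_set X)" for x
    using shrink_0[OF V(1,2)] that by simp
  show "shrink V (t, x) \<in> A" if "t \<in> {0..1}" "x \<in> A" for t x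
    using shrink_in[OF V(1,3) down_noncritical that(2,1)] .
  show "shrink V (1, x) \<in> A"
    if "x \<in> topspace (top_of_set X)" and u: "(\<Sum>\<sigma>\<in>C. Min (x ` \<sigma>)) * (2 * real (card V)) \<le> 1" for x
  proof -
    have x: "x \<in> X"
      using that by simp
    define \<tau> where "\<tau> = supp (shrink V (1, x))"
    have \<tau>: "\<tau> = {w. 1 / (2 * real (card V)) < x w}"
      unfolding \<tau>_def by (rule shrink_support) (use V x in \<open>auto simp: realization_points_iff\<close>)
    have "\<tau> \<notin> C"
    proof
      assume "\<tau> \<in> C"
      have "1 / (2 * real (card V)) < Min (x ` \<tau>)"
        using finite_facet[OF \<open>\<tau> \<in> C\<close>] by (simp add: \<tau>)
      also have "\<dots> \<le> (\<Sum>\<sigma>\<in>C. Min (x ` \<sigma>))"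
        using \<open>\<tau> \<in> C\<close> Min_nonneg(1)[OF x] finite_C by (intro member_le_sum) auto
      finally show False
        using u cardV by (simp add: field_simps)
    qed
    then show ?thesis
      using in_A_iff[OF shrink_X[of 1 x]] x by (simp add: \<tau>_def)
  qed
qed (rule that, auto)

section \<open>The map onto the wedge of spheres\<close>

definition facet :: "nat \<Rightarrow> 'v set" where
  "facet = (SOME F. bij_betw F {..<card C} C)"

lemma facet: "bij_betw facet {..<card C} C"
  using someI_ex[OF ex_bij_betw_nat_finite[OF finite_C]] by (simp add: facet_def atLeast0LessThan)

definition corner :: "nat \<Rightarrow> nat \<Rightarrow> 'v" where
  "corner i = (SOME g. bij_betw g {..d} (facet i))"

lemma facet_in: "i < card C \<Longrightarrow> facet i \<in> C"
  using facet by (auto simp: bij_betw_def)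

lemma corner: "i < card C \<Longrightarrow> bij_betw (corner i) {..d} (facet i)"
  using someI_ex[OF ex_bij_betw_nat_finite[OF finite_facet(1)[OF facet_in[of i]]]] card_C[OF facet_in[of i]]
  by (simp add: corner_def atLeast0LessThan lessThan_Suc_atMost)

definition to_sphere :: "nat \<Rightarrow> ('v \<Rightarrow> real) \<Rightarrow> nat \<Rightarrow> real" where
  "to_sphere i x = stereo d (\<lambda>j. x (corner i j))"

definition facet_index :: "'v set \<Rightarrow> nat" where
  "facet_index = the_inv_into {..<card C} facet"

definition to_wedge :: "('v \<Rightarrow> real) \<Rightarrow> (nat \<times> (nat \<Rightarrow> real)) option" where
  "to_wedge x = (if supp x \<in> C then Some (facet_index (supp x), to_sphere (facet_index (supp x)) x) else None)"

lemma facet_index: "i < card C \<Longrightarrow> facet_index (facet i) = i"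
  using facet unfolding facet_index_def by (intro the_inv_into_f_f) (auto simp: bij_betw_def)

lemma facet_cases:
  assumes "\<sigma> \<in> C"
  obtains i where "i < card C" "\<sigma> = facet i"
  using assms facet by (auto simp: bij_betw_def)

abbreviation "face i \<equiv> realization_points (Pow (facet i))"

lemma face_sub:
  assumes "i < card C"
  shows "face i \<subseteq> X"
  using facet_in[OF assms] C_sub down by (intro realization_points_mono) blast

lemma corner_coordinates:
  assumes "i < card C" "x \<in> face i"
  shows "\<And>j. 0 \<le> x (corner i j)" "(\<Sum>j\<le>d. x (corner i j)) = 1"
    "Min ((\<lambda>j. x (corner i j)) ` {..d}) = Min (x ` facet i)"
proof -
  have x: "x \<in> X" "supp x \<subseteq> facet i"
    using assms face_sub by (auto simp: realization_points_def)
  show "0 \<le> x (corner i j)" for j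
    using X_nonneg[OF x(1)] .
  show "(\<Sum>j\<le>d. x (corner i j)) = 1"
    using sum.reindex_bij_betw[OF corner[OF assms(1)], of x] sum_X[OF x finite_facet(1)[OF facet_in[OF assms(1)]]]
    by simp
  have "corner i ` {..d} = facet i"
    using corner[OF assms(1)] by (simp add: bij_betw_def)
  then show "Min ((\<lambda>j. x (corner i j)) ` {..d}) = Min (x ` facet i)"
    by (metis image_image)
qed

lemma Min_facet:
  assumes "i < card C" "x \<in> X"
  shows "0 \<le> Min (x ` facet i)" "0 < Min (x ` facet i) \<longleftrightarrow> facet i \<subseteq> supp x"
  using Min_coordinates_nonneg[OF finite_facet[OF facet_in[OF assms(1)]] X_nonneg[OF assms(2)]] by auto

text \<open>On the boundary of a facet \<open>stereo\<close> yields the base point, which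
  \<open>wedge_collapse\<close> sends to \<open>None\<close>; \<open>to_wedge\<close> does the same,
  since a proper face of a facet in \<open>C\<close> is not in \<open>C\<close>. So the definition
  by cases is a composition of continuous maps on each closed facet.\<close>

lemma to_wedge_face:
  assumes i: "i < card C" and x: "x \<in> face i"
  shows "to_wedge x = wedge_collapse (\<lambda>_. base) (i, to_sphere i x)"
proof -
  note c = corner_coordinates[OF i x]
  have x': "x \<in> X" "supp x \<subseteq> facet i"
    using x face_sub[OF i] by (auto simp: realization_points_def)
  show ?thesis
  proof (cases "supp x = facet i")
    case True
    then have "0 < Min (x ` facet i)"
      using Min_facet(2)[OF i x'(1)] by simp
    then have "to_sphere i x 0 < 1"
      unfolding to_sphere_def using stereo_interior[OF c(1,2)] c(3) by simp
    then have "to_sphere i x \<noteq> base"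
      by auto
    then show ?thesis
      using facet_in[OF i] facet_index[OF i] by (simp add: to_wedge_def True wedge_collapse_def)
  next
    case False
    then have "Min (x ` facet i) = 0"
      using Min_facet[OF i x'(1)] x'(2) by (auto simp: less_le)
    then have "to_sphere i x = base"
      unfolding to_sphere_def using stereo_boundary[OF c(1,2)] c(3) by simp
    moreover have "supp x \<notin> C"
      using maximal[of "supp x" "facet i"] facet_in[OF i] C_sub x'(2) False by auto
    ultimately show ?thesis
      by (simp add: to_wedge_def wedge_collapse_def)
  qed
qed

lemma continuous_to_sphere:
  assumes i: "i < card C"
  shows "continuous_map (top_of_set (face i)) (nsphere d) (to_sphere i)"
proof -
  note c = corner_coordinates[OF i]
  have "continuous_on (face i) (to_sphere i)"
    unfolding to_sphere_def using continuous_on_coordinate c(1,2) by (rule continuous_on_stereo)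
  moreover have "to_sphere i x \<in> {x. (\<Sum>i\<le>d. (x i)\<^sup>2) = 1 \<and> (\<forall>i>d. x i = 0)}" if "x \<in> face i" for x
    using stereo_norm[OF c(1,2)[OF that]] by (simp add: to_sphere_def) (simp add: stereo_def Let_def)
  ultimately show ?thesis
    by (auto simp: nsphere euclidean_product_topology)
qed

lemma continuous_to_wedge:
  "continuous_map (top_of_set X) (wedge_of_spheres d (card C)) to_wedge"
proof (rule pasting_lemma_closed)
  \<comment> \<open>The index \<open>None\<close> stands for \<open>A\<close> and
    \<open>Some i\<close> for a closed facet of \<open>C\<close>. These sets form a finite closed
    cover of the realization.\<close>
  let ?T = "\<lambda>j. case j of None \<Rightarrow> A | Some i \<Rightarrow> face i"
  let ?f = "\<lambda>j. case j of None \<Rightarrow> (\<lambda>_. None) | Some i \<Rightarrow> (\<lambda>x. wedge_collapse (\<lambda>_. base) (i, to_sphere i x))"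
  let ?I = "insert None (Some ` {..<card C})"
  show "finite ?I"
    by simp
  have eq: "?f j x = to_wedge x" if "j \<in> ?I" "x \<in> X" "x \<in> ?T j" for j x
  proof (cases j)
    case None
    then show ?thesis
      using that in_A_iff by (simp add: to_wedge_def)
  next
    case (Some i)
    then show ?thesis
      using that to_wedge_face[of i x] by auto
  qed
  show "closedin (top_of_set X) (?T j)" if j: "j \<in> ?I" for j
  proof (cases j)
    case None
    have "closedin (top_of_set X) A"
      using Diff_subset down_noncritical by (rule closedin_subcomplex)
    then show ?thesis
      by (simp add: None)
  next
    case (Some i)
    then have "i < card C"
      using j by auto
    then have "facet i \<in> S"
      using facet_in C_sub by blast
    then have "Pow (facet i) \<subseteq> S"
      using down by blast
    then have "closedin (top_of_set X) (face i)"
      by (rule closedin_subcomplex) blast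
    then show ?thesis
      by (simp add: Some)
  qed
  show "continuous_map (subtopology (top_of_set X) (?T j)) (wedge_of_spheres d (card C)) (?f j)" if j: "j \<in> ?I" for j
  proof (cases j)
    case None
    then show ?thesis
      by (simp add: wedge_of_spheres_def topspace_wedge)
  next
    case (Some i)
    then have i: "i < card C"
      using j by auto
    have "continuous_map (nsphere d) (sum_topology (\<lambda>_. nsphere d) {..<card C}) (Pair i)"
      using i by (intro continuous_map_component_injection) simp
    moreover have "continuous_map (sum_topology (\<lambda>_. nsphere d) {..<card C}) (wedge_of_spheres d (card C))
        (wedge_collapse (\<lambda>_. base))"
      unfolding wedge_of_spheres_def using i nsphere_base
      by (intro quotient_imp_continuous_map quotient_map_wedge_collapse) auto
    ultimately have "continuous_map (top_of_set (face i)) (wedge_of_spheres d (card C))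
        (wedge_collapse (\<lambda>_. base) \<circ> (Pair i \<circ> to_sphere i))"
      using continuous_to_sphere[OF i] by (intro continuous_map_compose)
    then show ?thesis
      using Some face_sub[OF i] by (simp add: subtopology_subtopology inf_absorb2 o_def)
  qed
  show "?f i x = ?f j x" if "i \<in> ?I" "j \<in> ?I" "x \<in> topspace (top_of_set X) \<inter> ?T i \<inter> ?T j" for i j x
    using eq[of i x] eq[of j x] that by simp
  show "\<exists>j. j \<in> ?I \<and> x \<in> ?T j \<and> to_wedge x = ?f j x" if "x \<in> topspace (top_of_set X)" for x
  proof -
    have "\<exists>j\<in>?I. x \<in> ?T j"
    proof (cases "supp x \<in> C")
      case True
      then obtain i where "i < card C" "supp x = facet i"
        by (rule facet_cases)
      then show ?thesis
        using that by (intro bexI[of _ "Some i"]) (auto simp: realization_points_def)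
    next
      case False
      then show ?thesis
        using that in_A_iff by (intro bexI[of _ None]) auto
    qed
    then obtain j where j: "j \<in> ?I" "x \<in> ?T j"
      by blast
    then show ?thesis
      using eq[OF j(1) _ j(2)] that by (intro exI[of _ j]) simp
  qed
qed

lemma to_wedge_surj: "to_wedge ` X = topspace (wedge_of_spheres d (card C))"
proof
  show "to_wedge ` X \<subseteq> topspace (wedge_of_spheres d (card C))"
    using continuous_map_image_subset_topspace[OF continuous_to_wedge] by simp
  show "topspace (wedge_of_spheres d (card C)) \<subseteq> to_wedge ` X"
  proof
    fix p assume p: "p \<in> topspace (wedge_of_spheres d (card C))"
    show "p \<in> to_wedge ` X"
    proof (cases p)
      case None
      \<comment> \<open>The wedge point is present even if there are no spheres; a vertex outside
        \<open>C\<close> is mapped to it.\<close>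
      obtain v where v: "{v} \<in> S - C"
        using vertex by blast
      define x where "x w = (if w = v then 1 else 0 :: real)" for w
      have "supp x = {v}"
        by (auto simp: x_def)
      then have "x \<in> A"
        using v by (simp add: realization_points_def) (simp add: x_def)
      then have "x \<in> X" "to_wedge x = p"
        using A_sub in_A_iff[of x] None by (auto simp: to_wedge_def)
      then show ?thesis
        by blast
    next
      case (Some iz)
      obtain i z where iz: "iz = (i, z)"
        by (cases iz)
      have i: "i < card C" and z: "z \<noteq> base" "(\<Sum>j\<le>d. (z j)\<^sup>2) = 1" "\<And>j. d < j \<Longrightarrow> z j = 0"
        using p by (auto simp: Some iz wedge_of_spheres_def topspace_wedge wedge_collapse_def nsphere split: if_splits)
      obtain y where y: "\<forall>i. 0 \<le> y i" "(\<Sum>i\<le>d. y i) = 1" "0 < Min (y ` {..d})" "stereo d y = z"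
        using z(2,3,1) by (rule stereo_surj)
      define x where "x w = (if w \<in> facet i then y (the_inv_into {..d} (corner i) w) else 0)" for w
      have xc: "x (corner i j) = y j" if "j \<le> d" for j
        using corner[OF i] that by (auto simp: x_def bij_betw_def the_inv_into_f_f)
      have pos: "0 < y j" if "j \<le> d" for j
        using y(3) that by (auto simp: Min_gr_iff)
      have "supp x = facet i"
      proof -
        have "x w \<noteq> 0" if w: "w \<in> facet i" for w
        proof -
          obtain j where "j \<le> d" "w = corner i j"
            using w corner[OF i] by (auto simp: bij_betw_def)
          then show ?thesis
            using xc pos by fastforce
        qed
        then show ?thesis
          by (auto simp: x_def)
      qed
      moreover have "sum x (facet i) = 1"
        using sum.reindex_bij_betw[OF corner[OF i], of x] y(2) xc by simp
      moreover have "0 \<le> x w" for w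
        by (simp add: x_def y)
      ultimately have "x \<in> X" "x \<in> face i"
        using facet_in[OF i] C_sub by (auto simp: realization_points_def)
      moreover have "to_sphere i x = z"
        unfolding to_sphere_def y(4)[symmetric] by (rule stereo_cong) (rule xc)
      ultimately have "to_wedge x = p"
        using to_wedge_face[OF i] z(1) by (simp add: wedge_collapse_def Some iz)
      then show ?thesis
        using \<open>x \<in> X\<close> by blast
    qed
  qed
qed

text \<open>Off \<open>A\<close> the index in the image identifies the facet. The support is then
  the whole facet, so the minima are positive and \<open>stereo_inj\<close> applies.\<close>

lemma to_wedge_fibre:
  assumes x: "x \<in> X" "x' \<in> X" and eq: "to_wedge x = to_wedge x'"
  shows "x = x' \<or> x \<in> A \<and> x' \<in> A"
proof (cases "supp x \<in> C")
  case False
  then show ?thesis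
    using eq in_A_iff x by (auto simp: to_wedge_def split: if_splits)
next
  case True
  then have "supp x' \<in> C" "facet_index (supp x) = facet_index (supp x')"
    using eq by (auto simp: to_wedge_def split: if_splits)
  then obtain i where i: "i < card C" "supp x = facet i" "supp x' = facet i"
    using True by (metis facet_cases facet_index)
  then have f: "x \<in> face i" "x' \<in> face i"
    using x by (auto simp: realization_points_def)
  note c = corner_coordinates[OF i(1) f(1)] and c' = corner_coordinates[OF i(1) f(2)]
  have sphere: "stereo d (\<lambda>j. x (corner i j)) = stereo d (\<lambda>j. x' (corner i j))"
    using eq True \<open>supp x' \<in> C\<close> facet_index[OF i(1)] by (simp add: to_wedge_def to_sphere_def i)
  have Min: "0 < Min (x ` facet i)" "0 < Min (x' ` facet i)"
    using Min_facet(2)[OF i(1)] x i by simp_all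
  have *: "x (corner i j) = x' (corner i j)" if "j \<le> d" for j
    using c(1,2) Min(1)[folded c(3)] c'(1,2) Min(2)[folded c'(3)] sphere that by (rule stereo_inj)
  have "x w = x' w" for w
  proof (cases "w \<in> facet i")
    case True
    then obtain j where "j \<le> d" "w = corner i j"
      using corner[OF i(1)] by (auto simp: bij_betw_def)
    then show ?thesis
      using * by simp
  next
    case False
    then have "w \<notin> supp x" "w \<notin> supp x'"
      unfolding i(2,3) by auto
    then show ?thesis
      by simp
  qed
  then show ?thesis
    by blast
qed

theorem homotopy_equivalent_wedge_of_spheres:
  "geometric_realization S homotopy_equivalent_space wedge_of_spheres d (card C)"
proof -
  obtain g a where g: "homotopic_with (\<lambda>f. f ` A \<subseteq> A) (top_of_set X) (top_of_set X) id g"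
    "\<forall>x\<in>A. g x = a"
    by (rule collapsing_map)
  have "top_of_set X homotopy_equivalent_space wedge_of_spheres d (card C)"
  proof (rule homotopy_equivalent_quotient[OF _ _ _ _ _ _ _ g(1)])
    show "compact_space (top_of_set X)"
      using compact_realization_points[OF finite_S finite_simplex down]
      by (simp add: compact_space_subtopology)
    have "Hausdorff_space (nsphere d)"
      unfolding nsphere by (intro Hausdorff_space_subtopology) (simp add: Hausdorff_space_product_topology)
    then show "Hausdorff_space (wedge_of_spheres d (card C))"
      unfolding wedge_of_spheres_def using nsphere_base by (intro Hausdorff_space_wedge)
    show "to_wedge x = to_wedge y" if "x \<in> A" "y \<in> A" for x y
      using that in_A_iff[of x] in_A_iff[of y] A_sub by (auto simp: to_wedge_def)
    show "x = y \<or> x \<in> A \<and> y \<in> A"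
      if "x \<in> topspace (top_of_set X)" "y \<in> topspace (top_of_set X)" "to_wedge x = to_wedge y" for x y
      using to_wedge_fibre that by simp
    show "g x = a" if "x \<in> A" for x
      using g(2) that by blast
  qed (use continuous_to_wedge to_wedge_surj A_sub in simp_all)
  then show ?thesis
    by (simp add: geometric_realization_eq)
qed

end

section \<open>The matching on the Bier complex\<close>

text \<open>Disjointness of the parts becomes injectivity of \<open>fst\<close>: no element of [n]
  carries two labels. In this form the condition passes to subsets directly.\<close>

lemma deleted_join_iff:
  "\<sigma> \<in> deleted_join r K \<longleftrightarrow>
     snd ` \<sigma> \<subseteq> {1..r} \<and> (\<forall>i\<in>{1..r}. part \<sigma> i \<in> K i) \<and> inj_on fst \<sigma>" (is "?L \<longleftrightarrow> ?R")
proof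
  assume ?L
  then obtain A where A: "\<sigma> = (\<Union>i\<in>{1..r}. A i \<times> {i})" "\<forall>i\<in>{1..r}. A i \<in> K i" "disjoint_family_on A {1..r}"
    by (auto simp: deleted_join_def)
  then have "part \<sigma> i = A i" if "i \<in> {1..r}" for i
    using that by (auto simp: part_def)
  moreover have "inj_on fst \<sigma>"
    using A(3) unfolding A(1) disjoint_family_on_def inj_on_def by fastforce
  ultimately show ?R
    using A by auto
next
  assume R: ?R
  then have "disjoint_family_on (part \<sigma>) {1..r}"
    by (force simp: disjoint_family_on_def part_def inj_on_def)
  moreover have "\<sigma> = (\<Union>i\<in>{1..r}. part \<sigma> i \<times> {i})"
    using R by (force simp: part_def)
  ultimately show ?L
    using R unfolding deleted_join_def by blast
qed

lemma part_insert: "part (insert (a, j) \<sigma>) i = (if i = j then insert a (part \<sigma> i) else part \<sigma> i)"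
  by (auto simp: part_def)

lemma part_remove: "part (\<sigma> - {(a, j)}) i = (if i = j then part \<sigma> i - {a} else part \<sigma> i)"
  by (auto simp: part_def)

lemma rest_insert: "rest n (insert (a, j) \<sigma>) = rest n \<sigma> - {a}"
  by (auto simp: rest_def)

section \<open>The values a_i under removal and insertion of a vertex\<close>

definition candidates :: "nat \<Rightarrow> (nat \<times> nat) set \<Rightarrow> nat \<Rightarrow> nat set" where
  "candidates n \<sigma> i = rest n \<sigma> \<union> part \<sigma> i"

lemma finite_candidates: "finite \<sigma> \<Longrightarrow> finite (candidates n \<sigma> i)"
proof -
  assume "finite \<sigma>"
  moreover have "part \<sigma> i \<subseteq> fst ` \<sigma>"
    by (force simp: part_def)
  ultimately show ?thesis
    by (auto simp: candidates_def rest_def intro: finite_subset)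
qed

lemma aval_Suc_Min:
  assumes "C = {x \<in> candidates n \<sigma> (Suc i). aval n \<sigma> i < enat x}"
  shows "aval n \<sigma> (Suc i) = (if C = {} then \<infinity> else enat (Min C))"
  unfolding assms candidates_def aval.simps(2) Let_def ..

declare aval.simps(2) [simp del]

text \<open>As an infimum in \<open>enat\<close> the empty case is included, and one more candidate
  amounts to a binary minimum.\<close>

lemma aval_Suc:
  assumes "finite \<sigma>"
  shows "aval n \<sigma> (Suc i) = Inf (enat ` {x \<in> candidates n \<sigma> (Suc i). aval n \<sigma> i < enat x})"
proof -
  define C where "C = {x \<in> candidates n \<sigma> (Suc i). aval n \<sigma> i < enat x}"
  have fin: "finite C"
    using finite_candidates[OF assms] by (simp add: C_def)
  have "aval n \<sigma> (Suc i) = (if C = {} then \<infinity> else enat (Min C))"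
    using C_def by (rule aval_Suc_Min)
  also have "\<dots> = Inf (enat ` C)"
  proof (cases "C = {}")
    case False
    then have "Inf (enat ` C) = Min (enat ` C)"
      using fin by (simp add: cInf_eq_Min)
    also have "\<dots> = enat (Min C)"
      using fin False by (intro mono_Min_commute[symmetric]) (auto simp: mono_def)
    finally show ?thesis
      using False by simp
  qed (simp add: top_enat_def)
  finally show ?thesis
    by (simp only: C_def)
qed

lemma aval_Suc_in:
  assumes "finite \<sigma>" "aval n \<sigma> (Suc i) = enat a"
  shows "a \<in> candidates n \<sigma> (Suc i)" "aval n \<sigma> i < enat a"
proof -
  define C where "C = {x \<in> candidates n \<sigma> (Suc i). aval n \<sigma> i < enat x}"
  have "finite C"
    using finite_candidates[OF assms(1)] by (simp add: C_def)
  moreover have "C \<noteq> {}" "a = Min C"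
    using assms(2) unfolding aval_Suc_Min[OF C_def] by (auto split: if_splits)
  ultimately have "a \<in> C"
    by simp
  then show "a \<in> candidates n \<sigma> (Suc i)" "aval n \<sigma> i < enat a"
    by (simp_all add: C_def)
qed

lemma aval_Suc_le:
  assumes "finite \<sigma>" "x \<in> candidates n \<sigma> (Suc i)" "aval n \<sigma> i < enat x"
  shows "aval n \<sigma> (Suc i) \<le> enat x"
  unfolding aval_Suc[OF assms(1)] using assms(2,3) by (intro Inf_lower) blast

lemma aval_in:
  assumes "finite \<sigma>" "0 < i" "aval n \<sigma> i = enat a"
  shows "a \<in> candidates n \<sigma> i"
  using assms aval_Suc_in(1)[OF assms(1), of n "i - 1" a] by simp

lemma aval_less:
  assumes "finite \<sigma>" "i < j" "aval n \<sigma> i \<noteq> \<infinity>"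
  shows "aval n \<sigma> i < aval n \<sigma> j"
  using assms(2)
proof (induction j)
  case (Suc j)
  show ?case
  proof (cases "aval n \<sigma> (Suc j)")
    case (enat a)
    then have "aval n \<sigma> j < aval n \<sigma> (Suc j)"
      using aval_Suc_in[OF assms(1)] by simp
    then show ?thesis
      using Suc by (cases "i = j") auto
  next
    case infinity
    then show ?thesis
      using assms(3) by simp
  qed
qed simp

lemma aval_le:
  assumes "finite \<sigma>" "i \<le> j"
  shows "aval n \<sigma> i \<le> aval n \<sigma> j"
proof (cases "aval n \<sigma> i = \<infinity>")
  case True
  have "aval n \<sigma> j = \<infinity>"
    using assms(2) by (induction rule: dec_induct) (simp_all add: True aval_Suc_Min[OF refl])
  then show ?thesis by simp
next
  case False
  then show ?thesis
    using aval_less[OF assms(1), of i j n] assms(2) by (cases "i = j") auto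
qed

text \<open>Moving a vertex from its part to the rest inserts it into every candidate set.\<close>

lemma aval_remove_Suc:
  assumes "finite \<tau>" "inj_on fst \<tau>" "(x, j) \<in> \<tau>" "x \<in> {1..n}"
    and "aval n (\<tau> - {(x, j)}) k = aval n \<tau> k"
  shows "aval n (\<tau> - {(x, j)}) (Suc k) =
    (if aval n \<tau> k < enat x then min (enat x) (aval n \<tau> (Suc k)) else aval n \<tau> (Suc k))"
proof -
  have "rest n (\<tau> - {(x, j)}) = insert x (rest n \<tau>)"
  proof -
    have eq: "fst ` (\<tau> - {(x, j)}) = fst ` \<tau> - {x}"
      using inj_on_image_set_diff[OF assms(2), of \<tau> "{(x, j)}"] assms(3) by simp
    have "x \<in> fst ` \<tau>"
      using assms(3) by force
    then show ?thesis
      unfolding rest_def eq using assms(4) by blast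
  qed
  then have "candidates n (\<tau> - {(x, j)}) i = insert x (candidates n \<tau> i)" for i
    using assms(3) by (auto simp: candidates_def part_remove)
  then have "{y \<in> candidates n (\<tau> - {(x, j)}) (Suc k). aval n (\<tau> - {(x, j)}) k < enat y} =
     (if aval n \<tau> k < enat x then {x} else {}) \<union> {y \<in> candidates n \<tau> (Suc k). aval n \<tau> k < enat y}"
    using assms(5) by auto
  then show ?thesis
    unfolding aval_Suc[OF assms(1)] aval_Suc[OF finite_Diff[OF assms(1)]] by (simp add: inf_min)
qed

text \<open>While the earlier values agree, the next one is either kept or replaced by its minimum
  with \<open>x\<close>. So the first value that changes drops, which is all that a lexicographic
  comparison needs.\<close>

lemma aval_remove_cases:
  assumes \<tau>: "finite \<tau>" "inj_on fst \<tau>" "(x, j) \<in> \<tau>" "x \<in> {1..n}"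
  obtains "\<And>i. i \<le> r \<Longrightarrow> aval n (\<tau> - {(x, j)}) i = aval n \<tau> i"
  | k where "k < r" "\<And>i. i \<le> k \<Longrightarrow> aval n (\<tau> - {(x, j)}) i = aval n \<tau> i"
      "aval n (\<tau> - {(x, j)}) (Suc k) < aval n \<tau> (Suc k)"
proof -
  have "(\<forall>i\<le>r. aval n (\<tau> - {(x, j)}) i = aval n \<tau> i) \<or>
    (\<exists>k<r. (\<forall>i\<le>k. aval n (\<tau> - {(x, j)}) i = aval n \<tau> i) \<and>
      aval n (\<tau> - {(x, j)}) (Suc k) < aval n \<tau> (Suc k))"
  proof (induction r)
    case (Suc r)
    then consider "\<forall>i\<le>r. aval n (\<tau> - {(x, j)}) i = aval n \<tau> i"
      | "\<exists>k<r. (\<forall>i\<le>k. aval n (\<tau> - {(x, j)}) i = aval n \<tau> i) \<and>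
      aval n (\<tau> - {(x, j)}) (Suc k) < aval n \<tau> (Suc k)"
      by blast
    then show ?case
    proof cases
      case 1
      then have "aval n (\<tau> - {(x, j)}) (Suc r) \<le> aval n \<tau> (Suc r)"
        using aval_remove_Suc[OF \<tau>, of r] by simp
      then consider "aval n (\<tau> - {(x, j)}) (Suc r) = aval n \<tau> (Suc r)"
        | "aval n (\<tau> - {(x, j)}) (Suc r) < aval n \<tau> (Suc r)"
        by fastforce
      then show ?thesis
      proof cases
        case 1
        then show ?thesis
          using \<open>\<forall>i\<le>r. _ i\<close> le_Suc_eq by metis
      next
        case 2
        then show ?thesis
          using \<open>\<forall>i\<le>r. _ i\<close> by blast
      qed
    next
      case 2
      then show ?thesis
        using less_SucI by blast
    qed
  qed simp
  then show ?thesis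
    using that by blast
qed

text \<open>The freed element \<open>a\<close> enters every candidate set, but up to step
  \<open>j\<close> the minimum is at most \<open>a\<close> already, and later steps only look above
  \<open>a\<close>. So a downward standard move keeps the whole vector.\<close>

lemma aval_remove:
  assumes \<tau>: "finite \<tau>" "inj_on fst \<tau>" "(a, j) \<in> \<tau>" "a \<in> {1..n}" and a: "aval n \<tau> j = enat a"
  shows "aval n (\<tau> - {(a, j)}) i = aval n \<tau> i"
proof (induction i)
  case (Suc i)
  have "min (enat a) (aval n \<tau> (Suc i)) = aval n \<tau> (Suc i)" if "aval n \<tau> i < enat a"
  proof -
    have "i < j"
      using that aval_le[OF \<tau>(1), of j i n] a by (metis not_le)
    then have "aval n \<tau> (Suc i) \<le> enat a"
      using aval_le[OF \<tau>(1), of "Suc i" j n] a by simp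
    then show ?thesis
      by (simp add: min_def)
  qed
  then show ?case
    using aval_remove_Suc[OF \<tau> Suc] by simp
qed simp

text \<open>This does not follow from \<open>aval_remove\<close>, because \<open>a\<close> is known
  to be the value at \<open>j\<close> for \<open>\<sigma>\<close> only, not for the larger simplex.
  Instead, the values of \<open>\<sigma>\<close> before step \<open>j\<close> lie strictly below
  \<open>a\<close>, and at step \<open>j\<close> the inserted \<open>a\<close> is itself a
  candidate.\<close>

lemma aval_insert:
  assumes "finite \<sigma>" "inj_on fst \<sigma>" "a \<in> rest n \<sigma>" and a: "aval n \<sigma> j = enat a"
  shows "aval n (insert (a, j) \<sigma>) i = aval n \<sigma> i"
proof -
  define \<tau> where "\<tau> = insert (a, j) \<sigma>"
  have a': "a \<notin> fst ` \<sigma>" "a \<in> {1..n}"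
    using assms(3) by (auto simp: rest_def)
  then have "(a, j) \<notin> \<sigma>"
    by force
  then have \<sigma>: "\<sigma> = \<tau> - {(a, j)}"
    by (auto simp: \<tau>_def)
  have \<tau>: "finite \<tau>" "inj_on fst \<tau>" "(a, j) \<in> \<tau>"
    using assms(1,2) a' by (auto simp: \<tau>_def)
  note remove = aval_remove_Suc[OF \<tau> a'(2), folded \<sigma>]
  have "aval n \<sigma> i = aval n \<tau> i"
  proof (induction i)
    case (Suc i)
    show ?case
    proof (cases "aval n \<tau> i < enat a")
      case True
      then have lt: "aval n \<sigma> i < enat a"
        using Suc by simp
      then have "i < j"
        using aval_le[OF assms(1), of j i n] a by (metis not_le)
      show ?thesis
      proof (cases "Suc i = j")
        case True
        have "a \<in> candidates n \<tau> (Suc i)"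
          using True by (simp add: candidates_def \<tau>_def part_def)
        then have "aval n \<tau> (Suc i) \<le> enat a"
          using aval_Suc_le[OF \<tau>(1)] \<open>aval n \<tau> i < enat a\<close> by blast
        then show ?thesis
          using remove[OF Suc] by (simp add: min_def)
      next
        case False
        then have "aval n \<sigma> (Suc i) < enat a"
          using aval_less[OF assms(1), of "Suc i" j n] aval_le[OF assms(1), of "Suc i" j n] a \<open>i < j\<close>
          by (cases "aval n \<sigma> (Suc i)") auto
        then show ?thesis
          using remove[OF Suc] by (auto simp: min_def split: if_splits)
      qed
    next
      case False
      then show ?thesis
        using remove[OF Suc] by (simp)
    qed
  qed simp
  then show ?thesis
    by (simp add: \<tau>_def)
qed

section \<open>The extended matching of an Alexander tuple\<close>

locale alexander_complexes =
  fixes n r :: nat and K :: "nat \<Rightarrow> nat set set"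
  assumes complex: "\<And>i. i \<in> {1..r} \<Longrightarrow> abstract_complex n (K i)"
    and tuple: "alexander_tuple n r K"
    and one: "{1} \<in> K 1"
begin

abbreviation "\<Delta> \<equiv> bier r K"

lemma r_pos: "0 < r"
proof -
  have "\<exists>i\<in>{1..r}. ({} :: nat set) \<in> K i"
    using tuple unfolding alexander_tuple_def collective_unavoidable_def
    by (elim conjE allE[of _ "\<lambda>_. {}"]) (auto simp: disjoint_family_on_def)
  then show ?thesis
    by auto
qed

lemma part_in: "\<sigma> \<in> \<Delta> \<Longrightarrow> i \<in> {1..r} \<Longrightarrow> part \<sigma> i \<in> K i"
  by (simp add: deleted_join_iff)

lemma simplex_subset: "\<sigma> \<in> \<Delta> \<Longrightarrow> \<sigma> \<subseteq> {1..n} \<times> {1..r}"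
proof (clarify)
  fix v i assume \<sigma>: "\<sigma> \<in> \<Delta>" "(v, i) \<in> \<sigma>"
  then have i: "i \<in> {1..r}"
    by (force simp: deleted_join_iff)
  then have "part \<sigma> i \<subseteq> {1..n}"
    using part_in[OF \<sigma>(1) i] complex[OF i] by (auto simp: abstract_complex_def)
  then show "v \<in> {1..n} \<and> i \<in> {1..r}"
    using \<sigma>(2) i by (auto simp: part_def)
qed

lemma simplex_finite: "\<sigma> \<in> \<Delta> \<Longrightarrow> finite \<sigma>"
  using simplex_subset finite_subset by blast

lemma simplex_inj: "\<sigma> \<in> \<Delta> \<Longrightarrow> inj_on fst \<sigma>"
  by (simp add: deleted_join_iff)

lemma finite_bier: "finite \<Delta>"
proof (rule finite_subset)
  show "\<Delta> \<subseteq> Pow ({1..n} \<times> {1..r})"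
    using simplex_subset by blast
qed simp

lemma bier_down: "\<sigma> \<in> \<Delta> \<Longrightarrow> \<tau> \<subseteq> \<sigma> \<Longrightarrow> \<tau> \<in> \<Delta>"
proof -
  assume \<sigma>: "\<sigma> \<in> \<Delta>" "\<tau> \<subseteq> \<sigma>"
  have "part \<tau> i \<in> K i" if i: "i \<in> {1..r}" for i
  proof -
    have "part \<tau> i \<subseteq> part \<sigma> i"
      using \<sigma>(2) by (auto simp: part_def)
    then show ?thesis
      using part_in[OF \<sigma>(1) i] complex[OF i] by (simp add: abstract_complex_def)
  qed
  moreover have "snd ` \<tau> \<subseteq> {1..r}" "inj_on fst \<tau>"
    using \<sigma> by (auto simp: deleted_join_iff intro: inj_on_subset)
  ultimately show ?thesis
    by (simp add: deleted_join_iff)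
qed

lemma empty_in: "{} \<in> \<Delta>"
  using complex by (simp add: deleted_join_iff part_def abstract_complex_def)

lemma insert_in:
  assumes "\<sigma> \<in> \<Delta>" "j \<in> {1..r}" "a \<in> rest n \<sigma>" "insert a (part \<sigma> j) \<in> K j"
  shows "insert (a, j) \<sigma> \<in> \<Delta>"
  using assms by (auto simp: deleted_join_iff part_insert rest_def)

text \<open>Finite values increase strictly with the index, so the least movable value sits at the
  least movable index.\<close>

lemma min_movable_iff:
  assumes "\<sigma> \<in> \<Delta>"
  shows "min_movable n r K \<sigma> j \<longleftrightarrow> movable n r K \<sigma> j \<and> (\<forall>k<j. \<not> movable n r K \<sigma> k)"
proof -
  have fin: "aval n \<sigma> k \<noteq> \<infinity>" if "movable n r K \<sigma> k" for k
    using that by (auto simp: movable_def)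
  show ?thesis
  proof (intro iffI conjI allI impI notI)
    fix k assume "min_movable n r K \<sigma> j" "k < j" "movable n r K \<sigma> k"
    then show False
      using aval_less[OF simplex_finite[OF assms], of k j n] fin[of k] by (auto simp: min_movable_def)
  next
    assume j: "movable n r K \<sigma> j \<and> (\<forall>k<j. \<not> movable n r K \<sigma> k)"
    have "aval n \<sigma> j \<le> aval n \<sigma> k" if "movable n r K \<sigma> k" for k
      using j that aval_le[OF simplex_finite[OF assms], of j k n] by (meson not_le)
    then show "min_movable n r K \<sigma> j"
      using j by (simp add: min_movable_def)
  qed (simp add: min_movable_def)
qed

lemma min_movable_unique:
  "\<sigma> \<in> \<Delta> \<Longrightarrow> min_movable n r K \<sigma> j \<Longrightarrow> min_movable n r K \<sigma> k \<Longrightarrow> j = k"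
  by (metis min_movable_iff linorder_neqE_nat)

lemma min_movable_ex: "movable n r K \<sigma> j \<Longrightarrow> \<sigma> \<in> \<Delta> \<Longrightarrow> \<exists>k. min_movable n r K \<sigma> k"
  using exists_least_iff[of "movable n r K \<sigma>"] min_movable_iff by blast

text \<open>The move changes no value, and the values before index \<open>j\<close> lie below
  \<open>a\<close>, so their movability is unaffected. Both simplices therefore select the same
  \<open>j\<close>, which makes the standard move an involution.\<close>

lemma min_movable_insert:
  assumes \<sigma>: "\<sigma> \<in> \<Delta>" and a: "a \<in> rest n \<sigma>" "aval n \<sigma> j = enat a" and \<tau>: "insert (a, j) \<sigma> \<in> \<Delta>"
  shows "min_movable n r K (insert (a, j) \<sigma>) j \<longleftrightarrow> min_movable n r K \<sigma> j"
proof -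
  have eq: "aval n (insert (a, j) \<sigma>) i = aval n \<sigma> i" for i
    using aval_insert[OF simplex_finite[OF \<sigma>] simplex_inj[OF \<sigma>] a] .
  have j: "j \<in> {1..r}"
    using simplex_subset[OF \<tau>] by auto
  have "insert a (part \<sigma> j) \<in> K j"
    using part_in[OF \<tau> j] by (simp add: part_insert)
  then have "movable n r K \<sigma> j" "movable n r K (insert (a, j) \<sigma>) j"
    using j a by (auto simp: movable_def eq part_insert)
  moreover have "movable n r K (insert (a, j) \<sigma>) k \<longleftrightarrow> movable n r K \<sigma> k" if "k < j" for k
  proof -
    have "b \<noteq> a" if "aval n \<sigma> k = enat b" for b
      using aval_less[OF simplex_finite[OF \<sigma>] \<open>k < j\<close>, of n] a that by simp
    then show ?thesis
      using that by (auto simp: movable_def eq part_insert rest_insert)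
  qed
  ultimately show ?thesis
    by (simp add: min_movable_iff \<sigma> \<tau>)
qed

definition matching :: "((nat \<times> nat) set \<times> (nat \<times> nat) set) set" where
  "matching = {(\<sigma>, \<tau>). \<sigma> \<in> \<Delta> \<and> (\<exists>j a. min_movable n r K \<sigma> j \<and> aval n \<sigma> j = enat a \<and>
     a \<in> rest n \<sigma> \<and> \<tau> = insert (a, j) \<sigma>)}"

lemma matchingE:
  assumes "(\<sigma>, \<tau>) \<in> matching"
  obtains j a where "\<sigma> \<in> \<Delta>" "\<tau> \<in> \<Delta>" "min_movable n r K \<sigma> j" "min_movable n r K \<tau> j"
    "aval n \<sigma> j = enat a" "aval n \<tau> = aval n \<sigma>" "a \<in> rest n \<sigma>" "(a, j) \<notin> \<sigma>"
    "\<tau> = insert (a, j) \<sigma>"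
proof -
  from assms obtain j a where *: "\<sigma> \<in> \<Delta>" "min_movable n r K \<sigma> j" "aval n \<sigma> j = enat a"
     "a \<in> rest n \<sigma>" "\<tau> = insert (a, j) \<sigma>"
    by (auto simp: matching_def)
  have "(a, j) \<notin> \<sigma>"
    using *(4) by (force simp: rest_def)
  moreover from this have "j \<in> {1..r}" "insert a (part \<sigma> j) \<in> K j"
    using *(2,3) by (auto simp: min_movable_def movable_def part_def)
  then have "\<tau> \<in> \<Delta>"
    using insert_in * by simp
  ultimately show ?thesis
    using that[of j a] * min_movable_insert[of \<sigma> a j]
      aval_insert[of \<sigma> a n j] simplex_finite[of \<sigma>] simplex_inj[of \<sigma>]
    by (simp add: fun_eq_iff)
qed

lemma min_movable_cases:
  assumes "\<sigma> \<in> \<Delta>" "min_movable n r K \<sigma> j"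
  obtains a where "aval n \<sigma> j = enat a" "a \<in> rest n \<sigma>" "a \<notin> part \<sigma> j" "(\<sigma>, insert (a, j) \<sigma>) \<in> matching"
  | a where "aval n \<sigma> j = enat a" "a \<in> part \<sigma> j" "(\<sigma> - {(a, j)}, \<sigma>) \<in> matching"
proof -
  from assms(2) obtain a where a: "aval n \<sigma> j = enat a" "a \<in> rest n \<sigma> \<or> a \<in> part \<sigma> j"
    by (auto simp: min_movable_def movable_def)
  show ?thesis
  proof (cases "a \<in> part \<sigma> j")
    case False
    then show ?thesis
      using that(1)[of a] a assms by (auto simp: matching_def)
  next
    case True
    define \<tau> where "\<tau> = \<sigma> - {(a, j)}"
    have aj: "(a, j) \<in> \<sigma>" "a \<in> {1..n}"
      using True simplex_subset[OF assms(1)] by (auto simp: part_def)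
    then have ins: "insert (a, j) \<tau> = \<sigma>"
      by (auto simp: \<tau>_def)
    have \<tau>: "\<tau> \<in> \<Delta>"
      using bier_down[OF assms(1)] by (simp add: \<tau>_def)
    have "fst ` \<tau> = fst ` \<sigma> - {a}"
      unfolding \<tau>_def using inj_on_image_set_diff[OF simplex_inj[OF assms(1)], of \<sigma> "{(a, j)}"] aj by simp
    then have rest: "a \<in> rest n \<tau>"
      using aj by (simp add: rest_def)
    have "aval n \<tau> j = enat a"
      unfolding \<tau>_def using aval_remove[OF simplex_finite[OF assms(1)] simplex_inj[OF assms(1)] aj a(1)] a(1) by simp
    then have "(\<tau>, \<sigma>) \<in> matching"
      using min_movable_insert[of \<tau> a j] \<tau> rest ins assms unfolding matching_def by auto
    then show ?thesis
      using that(2)[of a] a True by (simp add: \<tau>_def)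
  qed
qed

text \<open>The distinguished vertex is not among these simplices: it has a movable element, whose
  move leads to the empty simplex.\<close>

definition critical :: "(nat \<times> nat) set set" where
  "critical = {\<sigma> \<in> \<Delta>. \<forall>j. \<not> movable n r K \<sigma> j}"

lemma matching_not_critical:
  assumes "(\<sigma>, \<tau>) \<in> matching"
  shows "\<sigma> \<in> \<Delta> - critical" "\<tau> \<in> \<Delta> - critical"
  using assms by (auto simp: critical_def min_movable_def elim!: matchingE)

lemma matching_unique:
  assumes "\<sigma> \<in> \<Delta> - critical"
  shows "\<exists>!p. p \<in> matching \<and> (\<sigma> = fst p \<or> \<sigma> = snd p)"
proof -
  from assms obtain j where \<sigma>: "\<sigma> \<in> \<Delta>" and j: "min_movable n r K \<sigma> j"
    using min_movable_ex by (auto simp: critical_def)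
  have j_eq: "k = j" if "min_movable n r K \<sigma> k" for k
    using min_movable_unique[OF \<sigma> that j] .
  from \<sigma> j show ?thesis
  proof (cases rule: min_movable_cases)
    case (1 a)
    show ?thesis
    proof (rule ex1I)
      show "(\<sigma>, insert (a, j) \<sigma>) \<in> matching \<and> (\<sigma> = fst (\<sigma>, insert (a, j) \<sigma>) \<or> \<sigma> = snd (\<sigma>, insert (a, j) \<sigma>))"
        using 1 by simp
      fix p assume "p \<in> matching \<and> (\<sigma> = fst p \<or> \<sigma> = snd p)"
      then consider \<tau> where "p = (\<sigma>, \<tau>)" "(\<sigma>, \<tau>) \<in> matching" | \<tau> where "p = (\<tau>, \<sigma>)" "(\<tau>, \<sigma>) \<in> matching"
        by (cases p) auto
      then show "p = (\<sigma>, insert (a, j) \<sigma>)"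
      proof cases
        case p: (1 \<tau>)
        from p(2) show ?thesis
          by (rule matchingE) (use p 1 j_eq in auto)
      next
        case p: (2 \<tau>)
        from p(2) show ?thesis
          by (rule matchingE) (use p 1 j_eq in \<open>auto simp: part_def\<close>)
      qed
    qed
  next
    case (2 a)
    show ?thesis
    proof (rule ex1I)
      show "(\<sigma> - {(a, j)}, \<sigma>) \<in> matching \<and> (\<sigma> = fst (\<sigma> - {(a, j)}, \<sigma>) \<or> \<sigma> = snd (\<sigma> - {(a, j)}, \<sigma>))"
        using 2 by simp
      fix p assume "p \<in> matching \<and> (\<sigma> = fst p \<or> \<sigma> = snd p)"
      then consider \<tau> where "p = (\<sigma>, \<tau>)" "(\<sigma>, \<tau>) \<in> matching" | \<tau> where "p = (\<tau>, \<sigma>)" "(\<tau>, \<sigma>) \<in> matching"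
        by (cases p) auto
      then show "p = (\<sigma> - {(a, j)}, \<sigma>)"
      proof cases
        case p: (1 \<tau>)
        from p(2) show ?thesis
          by (rule matchingE) (use p 2 j_eq in \<open>auto simp: part_def\<close>)
      next
        case p: (2 \<tau>)
        from p(2) show ?thesis
          by (rule matchingE) (use p 2 j_eq in auto)
      qed
    qed
  qed
qed

lemma matching_acyclic:
  "acyclic {(\<alpha>', \<alpha>). \<alpha>' \<noteq> \<alpha> \<and> (\<exists>\<beta>'. (\<alpha>', \<beta>') \<in> matching) \<and>
     (\<exists>w. w \<notin> \<alpha>' \<and> (\<alpha>, insert w \<alpha>') \<in> matching)}" (is "acyclic ?R")
proof (rule acyclic_subset)
  \<comment> \<open>\<open>lex\<close> compares lists of equal length entry by entry, so the index
    is cast to \<open>enat\<close> and appended as the least significant entry.\<close>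
  define f where "f \<alpha> = map (aval n \<alpha>) [1..<Suc r] @ [enat (THE j. min_movable n r K \<alpha> j)]" for \<alpha>
  let ?L = "inv_image (lex {(x, y). x < y}) f"
  show "acyclic ?L"
    by (intro wf_acyclic wf_inv_image wf_lex wf)
  show "?R \<subseteq> ?L"
  proof clarify
    fix \<alpha>' \<alpha> \<beta>' x i
    assume ne: "\<alpha>' \<noteq> \<alpha>" and \<alpha>': "(\<alpha>', \<beta>') \<in> matching"
      and xi: "(x, i) \<notin> \<alpha>'" and \<alpha>: "(\<alpha>, insert (x, i) \<alpha>') \<in> matching"
    define \<beta> where "\<beta> = insert (x, i) \<alpha>'"
    obtain j a where j: "\<alpha> \<in> \<Delta>" "\<beta> \<in> \<Delta>" "min_movable n r K \<alpha> j" "aval n \<alpha> j = enat a"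
        "aval n \<beta> = aval n \<alpha>" "(a, j) \<notin> \<alpha>" "\<beta> = insert (a, j) \<alpha>"
      using \<alpha>[folded \<beta>_def] by (rule matchingE) (rule that)
    obtain j' a' where j': "\<alpha>' \<in> \<Delta>" "min_movable n r K \<alpha>' j'" "aval n \<alpha>' j' = enat a'" "a' \<in> rest n \<alpha>'"
      using \<alpha>' by (rule matchingE) (rule that)
    have the_eq: "(THE j. min_movable n r K \<alpha> j) = j" "(THE j. min_movable n r K \<alpha>' j) = j'"
      using j(1,3) j'(1,2) min_movable_unique by blast+
    have \<alpha>'_eq: "\<alpha>' = \<beta> - {(x, i)}"
      using xi by (simp add: \<beta>_def)
    then have "(a, j) \<noteq> (x, i)"
      using ne j(6,7) by auto
    then have aj: "(a, j) \<in> \<alpha>'"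
      using j(7) by (auto simp: \<alpha>'_eq)
    have "(x, i) \<in> \<beta>" "x \<in> {1..n}"
      using simplex_subset[OF j(2)] by (auto simp: \<beta>_def)
    with simplex_finite[OF j(2)] simplex_inj[OF j(2)] show "(\<alpha>', \<alpha>) \<in> ?L"
    proof (cases rule: aval_remove_cases[where n = n and r = r, case_names same less])
      case same
      then have eq: "aval n \<alpha>' i = aval n \<alpha> i" if "i \<le> r" for i
        using that j(5) by (simp add: \<alpha>'_eq)
      have jr: "j \<in> {1..r}" "j' \<in> {1..r}"
        using j(3) j'(2) by (auto simp: min_movable_def movable_def)
      \<comment> \<open>The vertex \<open>(a, j)\<close> that was added to \<alpha> is not the one
        discarded, so it stays in \<alpha>' and keeps \<open>j\<close> movable; hence
        \<open>j'\<close> is at most \<open>j\<close>. Equality is impossible, as \<alpha>' is a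
        lower partner and its value at \<open>j'\<close> lies in B.\<close>
      have "j' \<noteq> j"
      proof
        assume "j' = j"
        then have "a' = a"
          using eq[of j] j(4) j'(3) jr by simp
        then show False
          using aj j'(4) by (force simp: rest_def)
      qed
      moreover have "movable n r K \<alpha>' j"
        using aj jr(1) eq[of j] j(4) by (simp add: movable_def part_def)
      then have "\<not> j < j'"
        using j'(2) min_movable_iff[OF j'(1)] by blast
      ultimately have "j' < j"
        by simp
      have "map (aval n \<alpha>') [1..<Suc r] = map (aval n \<alpha>) [1..<Suc r]"
        using eq by (intro map_cong) auto
      then show ?thesis
        unfolding in_inv_image f_def the_eq using \<open>j' < j\<close>
        by (simp only:) (intro lex_append_leftI, simp)
    next
      case (less k)
      then have split: "[1..<Suc r] = [1..<Suc k] @ Suc k # [Suc (Suc k)..<Suc r]"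
        using upt_add_eq_append[of 1 "Suc k" "r - k"] by (simp add: upt_conv_Cons del: upt_Suc)
      have eq: "map (aval n \<alpha>') [1..<Suc k] = map (aval n \<alpha>) [1..<Suc k]"
        using less(2) j(5) by (intro map_cong) (auto simp: \<alpha>'_eq)
      have "aval n \<alpha>' (Suc k) < aval n \<alpha> (Suc k)"
        using less(3) j(5) by (simp add: \<alpha>'_eq)
      then show ?thesis
        unfolding in_inv_image f_def split map_append list.map eq append.simps append_assoc
        by (intro lex_append_leftI) simp
    qed
  qed
qed

section \<open>Dimension and maximality of the unmatched simplices\<close>

lemma card_simplex: "\<sigma> \<in> \<Delta> \<Longrightarrow> card \<sigma> = n - card (rest n \<sigma>)"
proof -
  assume \<sigma>: "\<sigma> \<in> \<Delta>"
  have "fst ` \<sigma> \<subseteq> {1..n}"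
    using simplex_subset[OF \<sigma>] by auto
  then have "card (rest n \<sigma>) = n - card (fst ` \<sigma>)" "card (fst ` \<sigma>) \<le> n"
    using card_Diff_subset[of "fst ` \<sigma>" "{1..n}"] simplex_finite[OF \<sigma>] card_mono[of "{1..n}" "fst ` \<sigma>"]
    by (auto simp: rest_def)
  then show ?thesis
    using card_image[OF simplex_inj[OF \<sigma>]] by simp
qed

lemma card_rest_ge:
  assumes "\<sigma> \<in> \<Delta>"
  shows "r - 1 \<le> card (rest n \<sigma>)"
proof -
  have "fst ` \<sigma> = (\<Union>i\<in>{1..r}. part \<sigma> i)"
    using simplex_subset[OF assms] by (force simp: part_def)
  then show ?thesis
    using tuple part_in[OF assms] by (simp add: alexander_tuple_def rest_def)
qed

lemma card_rest_critical:
  assumes "\<sigma> \<in> critical"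
  shows "card (rest n \<sigma>) \<le> r - 1"
proof -
  have \<sigma>: "\<sigma> \<in> \<Delta>" and nm: "\<And>j. \<not> movable n r K \<sigma> j"
    using assms by (auto simp: critical_def)
  note fin = simplex_finite[OF \<sigma>]
  have in_rest: "a \<in> rest n \<sigma>" "insert a (part \<sigma> i) \<notin> K i" if "i \<in> {1..r}" "aval n \<sigma> i = enat a" for i a
    using nm[of i] that aval_in[OF fin, of i n a] by (auto simp: movable_def candidates_def)
  have "\<exists>k\<in>{1..r}. aval n \<sigma> k = \<infinity>"
  proof (rule ccontr)
    assume no: "\<not> ?thesis"
    define a where "a i = the_enat (aval n \<sigma> i)" for i
    have a: "aval n \<sigma> i = enat (a i)" if "i \<in> {1..r}" for i
    proof -
      have "aval n \<sigma> i \<noteq> \<infinity>"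
        using no bexI[OF _ that] by (rule contrapos_nn)
      then show ?thesis
        by (cases "aval n \<sigma> i") (simp_all add: a_def)
    qed
    \<comment> \<open>The a_i are distinct elements of B, so the enlarged parts stay disjoint. As
      nothing is movable, none of them lies in its complex, against unavoidability.\<close>
    define A where "A i = insert (a i) (part \<sigma> i)" for i
    have "A i \<subseteq> {1..n}" if "i \<in> {1..r}" for i
      using in_rest(1)[OF that a[OF that]] simplex_subset[OF \<sigma>] by (auto simp: A_def part_def rest_def)
    moreover have "disjoint_family_on A {1..r}"
      unfolding disjoint_family_on_def
    proof (intro ballI impI)
      fix i j assume ij: "i \<in> {1..r}" "j \<in> {1..r}" "i \<noteq> j"
      have "a i \<noteq> a j"
        using ij a[OF ij(1)] a[OF ij(2)] aval_less[OF fin, of i j n] aval_less[OF fin, of j i n]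
        by (cases i j rule: linorder_cases) auto
      moreover have "part \<sigma> i \<inter> part \<sigma> j = {}"
        using simplex_inj[OF \<sigma>] ij(3) unfolding part_def inj_on_def by fastforce
      moreover have "a k \<notin> part \<sigma> l" if "k \<in> {1..r}" for k l
        using in_rest(1)[OF that a[OF that]] by (force simp: rest_def part_def)
      ultimately show "A i \<inter> A j = {}"
        using ij by (auto simp: A_def)
    qed
    ultimately obtain i where "i \<in> {1..r}" "A i \<in> K i"
      using tuple unfolding alexander_tuple_def collective_unavoidable_def by blast
    then show False
      using in_rest(2)[of i "a i"] a by (simp add: A_def)
  qed
  then obtain k where k: "k \<in> {1..r}" "aval n \<sigma> k = \<infinity>"
    by blast
  have "rest n \<sigma> \<subseteq> (\<lambda>i. the_enat (aval n \<sigma> i)) ` {1..<r}"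
  proof
    fix b assume b: "b \<in> rest n \<sigma>"
    \<comment> \<open>An element of B is a candidate at every step, so it has been chosen or still
      exceeds the current value. At the infinite value a_k the latter fails, so it was chosen at
      some \<open>i < k \<le> r\<close>.\<close>
    have "(\<exists>i\<in>{1..l}. aval n \<sigma> i = enat b) \<or> aval n \<sigma> l < enat b" for l
    proof (induction l)
      case 0
      then show ?case
        using b by (simp add: rest_def zero_enat_def)
    next
      case (Suc l)
      then consider i where "i \<in> {1..l}" "aval n \<sigma> i = enat b" | "aval n \<sigma> l < enat b"
        by blast
      then show ?case
      proof cases
        case (1 i)
        then show ?thesis
          by (intro disjI1 bexI[of _ i]) auto
      next
        case 2
        then have "aval n \<sigma> (Suc l) \<le> enat b"
          using b by (intro aval_Suc_le[OF fin]) (auto simp: candidates_def)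
        then show ?thesis
          by (auto simp: order_le_less)
      qed
    qed
    from this[of k] obtain i where i: "i \<in> {1..k}" "aval n \<sigma> i = enat b"
      using k(2) by auto
    then have "i \<noteq> k"
      using k(2) by auto
    with i k show "b \<in> (\<lambda>i. the_enat (aval n \<sigma> i)) ` {1..<r}"
      by (intro image_eqI[of _ _ i]) auto
  qed
  then have "card (rest n \<sigma>) \<le> card {1..<r}"
    by (meson card_image_le card_mono finite_atLeastLessThan finite_imageI order_trans)
  then show ?thesis
    by simp
qed

lemma card_critical:
  assumes "\<sigma> \<in> critical"
  shows "card \<sigma> = Suc (n - r)"
proof -
  have "\<sigma> \<in> \<Delta>"
    using assms by (simp add: critical_def)
  moreover from this have "card (rest n \<sigma>) = r - 1"
    using card_rest_critical[OF assms] card_rest_ge by (simp add: order_antisym)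
  \<comment> \<open>Both \<open>0 < r\<close> and \<open>r \<le> n\<close> enter here: only then is
    \<open>n - (r - 1)\<close> equal to \<open>Suc (n - r)\<close> with truncated
    subtraction.\<close>
  ultimately show ?thesis
    using card_simplex[of \<sigma>] r_pos alexander_tuple_le[OF complex tuple one] by simp
qed

lemma critical_maximal:
  assumes "\<sigma> \<in> critical" "\<tau> \<in> \<Delta>" "\<sigma> \<subseteq> \<tau>"
  shows "\<tau> = \<sigma>"
proof -
  have "card \<tau> \<le> card \<sigma>"
    using card_critical[OF assms(1)] card_simplex[OF assms(2)] card_rest_ge[OF assms(2)] by simp
  then show ?thesis
    using card_seteq[OF simplex_finite[OF assms(2)] assms(3)] by simp
qed

text \<open>Here the choice of order with \<open>{1} \<in> K 1\<close> enters: for B = [n] the first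
  value is 1, and inserting it into the first part is allowed.\<close>

lemma empty_matched: "({}, {(1, 1)}) \<in> matching"
proof -
  have n: "1 \<le> n"
    using complex[of 1] one r_pos by (auto simp: abstract_complex_def)
  have "aval n {} (Suc 0) = (if {1..n} = {} then \<infinity> else enat (Min {1..n}))"
    by (rule aval_Suc_Min) (auto simp: candidates_def rest_def part_def zero_enat_def)
  also have "\<dots> = enat 1"
    using n by (auto intro: Min_eqI)
  finally have "aval n {} (Suc 0) = enat 1" .
  then have "min_movable n r K {} 1" "aval n {} 1 = enat 1"
    using n one r_pos by (auto simp: min_movable_iff[OF empty_in] movable_def rest_def part_def)
  then show ?thesis
    using empty_in n by (auto simp: matching_def rest_def)
qed

section \<open>Comparison with the discrete vector field \<open>D_field\<close>\<close>

lemma standard_move_eq: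
  "aval n \<sigma> j = enat a \<Longrightarrow>
    standard_move n \<sigma> j = (if a \<in> part \<sigma> j then \<sigma> - {(a, j)} else insert (a, j) \<sigma>)"
  by (simp add: standard_move_def)

lemma D_field_eq: "D_field n r K = {(\<alpha>, \<beta>) \<in> matching. \<alpha> \<noteq> {}}"
proof (intro equalityI subsetI; clarify)
  fix \<alpha> \<beta> assume "(\<alpha>, \<beta>) \<in> D_field n r K"
  then have *: "\<alpha> \<in> \<Delta>" "\<alpha> \<noteq> {}" "\<beta> \<in> \<Delta>" "\<alpha> \<subset> \<beta>"
    "matched_with n r K \<alpha> \<beta> \<or> matched_with n r K \<beta> \<alpha>"
    by (auto simp: D_field_def)
  from *(5) have "(\<alpha>, \<beta>) \<in> matching"
  proof
    assume "matched_with n r K \<alpha> \<beta>"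
    then obtain j where j: "min_movable n r K \<alpha> j" "\<beta> = standard_move n \<alpha> j"
      by (auto simp: matched_with_def)
    from *(1) j(1) show ?thesis
      by (cases rule: min_movable_cases) (use j(2) *(4) in \<open>auto simp: standard_move_eq\<close>)
  next
    assume "matched_with n r K \<beta> \<alpha>"
    then obtain j where j: "min_movable n r K \<beta> j" "\<alpha> = standard_move n \<beta> j"
      by (auto simp: matched_with_def)
    from *(3) j(1) show ?thesis
      by (cases rule: min_movable_cases) (use j(2) *(4) in \<open>auto simp: standard_move_eq\<close>)
  qed
  then show "(\<alpha>, \<beta>) \<in> matching \<and> \<alpha> \<noteq> {}"
    using *(2) by simp
next
  fix \<alpha> \<beta> assume m: "(\<alpha>, \<beta>) \<in> matching" and ne: "\<alpha> \<noteq> {}"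
  from m obtain j a where j: "\<alpha> \<in> \<Delta>" "\<beta> \<in> \<Delta>" "min_movable n r K \<alpha> j" "aval n \<alpha> j = enat a"
       "(a, j) \<notin> \<alpha>" "\<beta> = insert (a, j) \<alpha>"
    by (rule matchingE) (rule that)
  then have "\<beta> = standard_move n \<alpha> j"
    by (simp add: standard_move_eq part_def)
  with j(3) have "matched_with n r K \<alpha> \<beta>"
    by (auto simp: matched_with_def)
  then show "(\<alpha>, \<beta>) \<in> D_field n r K"
    using j(1,2,5,6) ne by (auto simp: D_field_def)
qed

text \<open>Leaving the empty simplex out of \<open>D_field\<close> breaks exactly one pair of
  \<open>matching\<close>. Its other member \<open>{(1, 1)}\<close> becomes critical, and it is the
  simplex taken out of the count.\<close>

lemma critical_simplices_eq:
  "critical_simplices \<Delta> (D_field n r K) - {{(1, 1)}} = critical"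
proof (intro equalityI subsetI)
  fix \<sigma> assume \<sigma>: "\<sigma> \<in> critical_simplices \<Delta> (D_field n r K) - {{(1, 1)}}"
  show "\<sigma> \<in> critical"
  proof (rule ccontr)
    assume "\<sigma> \<notin> critical"
    then have "\<sigma> \<in> \<Delta> - critical"
      using \<sigma> by (simp add: critical_simplices_def)
    from ex1_implies_ex[OF matching_unique[OF this]]
    obtain \<alpha> \<beta> where p: "(\<alpha>, \<beta>) \<in> matching" "\<sigma> = \<alpha> \<or> \<sigma> = \<beta>"
      by auto
    then have "\<alpha> = {}"
      using \<sigma> by (auto simp: critical_simplices_def D_field_eq)
    then have "(\<alpha>, \<beta>) = ({}, {(1, 1)})"
      using matching_unique[OF matching_not_critical(1)[OF empty_matched]] empty_matched p(1)
      by (elim ex1E) (metis fst_conv)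
    then show False
      using p(2) \<sigma> by (auto simp: critical_simplices_def)
  qed
next
  fix \<sigma> assume \<sigma>: "\<sigma> \<in> critical"
  have "\<sigma> \<noteq> \<alpha> \<and> \<sigma> \<noteq> \<beta>" if "(\<alpha>, \<beta>) \<in> matching" for \<alpha> \<beta>
    using matching_not_critical[OF that] \<sigma> by auto
  moreover have "\<sigma> \<in> \<Delta>"
    using \<sigma> by (simp add: critical_def)
  ultimately show "\<sigma> \<in> critical_simplices \<Delta> (D_field n r K) - {{(1, 1)}}"
    using empty_matched by (auto simp: critical_simplices_def D_field_eq)
qed

lemma contractible_noncritical: "contractible_space (geometric_realization (\<Delta> - critical))"
proof (rule acyclic_matching_contractible[OF _ _ _ _ _ matching_unique matching_acyclic])
  show "\<tau> \<in> \<Delta> - critical" if "\<sigma> \<in> \<Delta> - critical" "\<tau> \<subseteq> \<sigma>" for \<sigma> \<tau>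
    using that bier_down[of \<sigma> \<tau>] critical_maximal[of \<tau> \<sigma>] by auto
  show "{} \<in> \<Delta> - critical"
    using matching_not_critical(1)[OF empty_matched] .
  show "\<beta> \<in> \<Delta> - critical \<and> (\<exists>v. v \<notin> \<alpha> \<and> \<beta> = insert v \<alpha>)" if "(\<alpha>, \<beta>) \<in> matching" for \<alpha> \<beta>
  proof -
    from that obtain j a where "(a, j) \<notin> \<alpha>" "\<beta> = insert (a, j) \<alpha>"
      by (rule matchingE) (rule that)
    then show ?thesis
      using matching_not_critical(2)[OF that] by blast
  qed
qed (use finite_bier simplex_finite in auto)

end

theorem corollary4p4:
  fixes n r :: nat and K :: "nat \<Rightarrow> nat set set"
  assumes "\<And>i. i \<in> {1..r} \<Longrightarrow> abstract_complex n (K i)"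
    and "\<And>i. i \<in> {1..r} \<Longrightarrow> K i \<noteq> Pow {1..n}"
    and "alexander_tuple n r K"
    and "{1} \<in> K 1"
  shows "geometric_realization (bier r K) homotopy_equivalent_space
           wedge_of_spheres (n - r)
             (card (critical_simplices (bier r K) (D_field n r K) - {{(1, 1)}}))"
proof -
  interpret alexander_complexes n r K
    using assms by unfold_locales
  interpret facet_wedge "bier r K" critical "n - r"
  proof
    show "critical \<subseteq> bier r K"
      by (auto simp: critical_def)
    show "\<exists>v. {v} \<in> bier r K - critical"
      using matching_not_critical(2)[OF empty_matched] by blast
  qed (fact finite_bier simplex_finite bier_down card_critical critical_maximal contractible_noncritical)+
  show ?thesis
    unfolding critical_simplices_eq by (rule homotopy_equivalent_wedge_of_spheres)
qed

end
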